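(* Let $D$ be a directed graph. The topological space $|D|$, equipped with the topology DTop, is metrizable if and only if $D$ has a normal spanning tree.
   Context: Necklace: a strongly connected directed graph $N$ is a necklace if there is a family $(H_n)_{n\in\mathbb N}$ of finite strongly connected subgraphs with $N=\bigcup_n H_n$ and $H_i\cap H_j\neq\emptyset$ iff $|i-j|\le 1$. Ends of $D$: equivalence classes of necklaces in $D$, where two necklaces $N_1,N_2$ are equivalent if there are infinitely many disjoint $N_1$–$N_2$ paths and infinitely many disjoint $N_2$–$N_1$ paths; $\Omega(D)$ is the set of ends. For an end $\omega$ and finite $X\subseteq V(D)$, $C(X,\omega)$ is the unique strong component of $D-X$ containing all but finitely many vertices of the necklaces of $\omega$; an end $\eta$ lives in $C(X,\omega)$ if $C(X,\eta)=C(X,\omega)$. Normal trees: for a rooted undirected tree $T$ with tree order $\le_T$, a weak normal tree of $D$ is such a $T$ with $V(T)\subseteq V(D)$ such that (i) for every strongly connected subgraph $H$ of $D$ and all $\le_T$-incomparable $u,v\in V(H)\cap V(T)$ there is $w\in V(H)\cap V(T)$ with $w\le_T u,v$, and (ii) for all $u\le_T v$ in $V(T)$ there is a strongly connected subgraph of $D$ containing $u,v$ and avoiding every $w<_T u$. It is a normal tree if moreover for every ray of $T$ starting at the root some necklace of $D$ contains all but finitely many of its vertices. It is spanning if $V(T)=V(D)$. The space $|D|$ (Bürger–Melcher): there is a limit edge $v\omega$ from a vertex $v$ to an end $\omega$ if for every finite $X\subseteq V(D)\setminus\{v\}$ there is an edge of $D$ from $v$ to $C(X,\omega)$; symmetrically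 a limit edge $\omega v$; for distinct ends $\omega,\eta$ there is a limit edge $\omega\eta$ if for every finite $X$ with $C(X,\omega)\ne C(X,\eta)$ there is an edge from $C(X,\omega)$ to $C(X,\eta)$. $|D|$ consists of $D$ viewed as a 1-complex (each edge $uv$ a copy of $[0,1]$ with $0$ at $u$ and $1$ at $v$; inner points $(uv,\lambda)$, $\lambda\in(0,1)$), together with the ends as points and each limit edge $xy$ as a copy of $[0,1]$ glued with $0$ at $x$ and $1$ at $y$. DTop is generated by: for a vertex $v$, uniform stars of radius $\varepsilon$ (all points of edges and limit edges at $v$ at distance $<\varepsilon$ from $v$, together with $v$); for an inner point of an edge, open subintervals of the edge containing it; for an end $\omega$, sets $\hat C_\varepsilon(X,\omega)$ ($X$ finite, $\varepsilon>0$) consisting of the vertices of $C(X,\omega)$, the ends living in it, all inner points of edges and limit edges both of whose endpoints are vertices of or ends living in $C(X,\omega)$, and the inner points at distance $<\varepsilon$ from the respective endpoint of edges and limit edges with exactly one such endpoint; for an inner point $(xy,\lambda)$ of a limit edge, sets $\hat E_\varepsilon(X,xy)$ ($X$ finite containing the vertex endpoints among $x,y$) consisting of all inner points $(ab,\mu)$ of edges and limit edges with $|\mu-\lambda|<\varepsilon$, where $a=x$ if $x$ is a vertex and $a$ is a vertex of or an end living in $C(X,x)$ if $x$ is an end, and likewise $b$ with respect to $y$.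
   Formalization: D is assumed strongly connected (and nonempty): a normal spanning tree forces this, while e.g. the edgeless digraph on two vertices has a discrete, hence metrizable, |D| but no normal spanning tree, so the equivalence fails without it. *)

theory Defs
  imports
    "HOL-Analysis.Abstract_Metric_Spaces"
    "Graph_Theory.Graph_Theory"
begin

text \<open>
  Directed graphs are the library's \<^emph>\<open>pair digraphs\<close>: of arbitrary cardinality, without parallel
  edges, so that an edge is the pair of its endpoints. Inverse edges and loops are allowed.
\<close>

section \<open>Necklaces and ends\<close>

definition strong_subgraph :: "'a pair_pre_digraph \<Rightarrow> 'a pair_pre_digraph \<Rightarrow> bool" where
  "strong_subgraph H D \<longleftrightarrow> subgraph H D \<and> strongly_connected H"

definition necklace :: "'a pair_pre_digraph \<Rightarrow> bool" where
  "necklace N \<longleftrightarrow> strongly_connected N \<and>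
    (\<exists>H :: nat \<Rightarrow> 'a pair_pre_digraph.
      (\<forall>n. pair_fin_digraph (H n) \<and> strong_subgraph (H n) N) \<and>
      pverts N = (\<Union>n. pverts (H n)) \<and> parcs N = (\<Union>n. parcs (H n)) \<and>
      (\<forall>i j. pverts (H i) \<inter> pverts (H j) \<noteq> {} \<longleftrightarrow> \<bar>int i - int j\<bar> \<le> 1))"

definition necklaces_in :: "'a pair_pre_digraph \<Rightarrow> 'a pair_pre_digraph set" where
  "necklaces_in D = {N. necklace N \<and> subgraph N D}"

definition set_path :: "'a pair_pre_digraph \<Rightarrow> 'a set \<Rightarrow> 'a set \<Rightarrow> 'a list \<Rightarrow> bool" where
  "set_path D A B p \<longleftrightarrow> vpath p D \<and> set p \<inter> A = {hd p} \<and> set p \<inter> B = {last p}"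

definition inf_disjoint_paths ::
    "'a pair_pre_digraph \<Rightarrow> 'a pair_pre_digraph \<Rightarrow> 'a pair_pre_digraph \<Rightarrow> bool" where
  "inf_disjoint_paths D N1 N2 \<longleftrightarrow>
    (\<exists>P. infinite P \<and> (\<forall>p\<in>P. set_path D (pverts N1) (pverts N2) p) \<and>
      pairwise (\<lambda>p q. set p \<inter> set q = {}) P)"

definition necklace_rel :: "'a pair_pre_digraph \<Rightarrow> 'a pair_pre_digraph rel" where
  "necklace_rel D = {(N1, N2). N1 \<in> necklaces_in D \<and> N2 \<in> necklaces_in D \<and>
    inf_disjoint_paths D N1 N2 \<and> inf_disjoint_paths D N2 N1}"

definition ends :: "'a pair_pre_digraph \<Rightarrow> 'a pair_pre_digraph set set" where
  "ends D = necklaces_in D // necklace_rel D"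

definition end_comp :: "'a pair_pre_digraph \<Rightarrow> 'a set \<Rightarrow> 'a pair_pre_digraph set
    \<Rightarrow> ('a, 'a \<times> 'a) pre_digraph" where
  "end_comp D X \<omega> = (THE C. C \<in> pre_digraph.sccs (with_proj D \<restriction> (pverts D - X)) \<and>
    (\<forall>N\<in>\<omega>. finite (pverts N - verts C)))"


section \<open>Normal trees\<close>

text \<open>
  An undirected graph is a symmetric loopless digraph. The library's \<^const>\<open>tree\<close> does not apply to
  it, since there a pair of inverse arcs already counts as a cycle; hence the bound on the length.
\<close>

definition rooted_tree :: "'a pair_pre_digraph \<Rightarrow> 'a \<Rightarrow> bool" where
  "rooted_tree T r \<longleftrightarrow> pair_bidirected_digraph T \<and> strongly_connected T \<and>
    \<not> (\<exists>p. pre_digraph.cycle (with_proj T) p \<and> 3 \<le> length p) \<and> r \<in> pverts T"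

definition tree_le :: "'a pair_pre_digraph \<Rightarrow> 'a \<Rightarrow> 'a \<Rightarrow> 'a \<Rightarrow> bool" where
  "tree_le T r u v \<longleftrightarrow> (\<exists>p. vpath p T \<and> hd p = r \<and> last p = v \<and> u \<in> set p)"

definition weak_normal_tree :: "'a pair_pre_digraph \<Rightarrow> 'a pair_pre_digraph \<Rightarrow> 'a \<Rightarrow> bool" where
  "weak_normal_tree D T r \<longleftrightarrow> rooted_tree T r \<and> pverts T \<subseteq> pverts D \<and>
    (\<forall>H. strong_subgraph H D \<longrightarrow>
      (\<forall>u \<in> pverts H \<inter> pverts T. \<forall>v \<in> pverts H \<inter> pverts T.
        \<not> tree_le T r u v \<and> \<not> tree_le T r v u \<longrightarrow>
        (\<exists>w \<in> pverts H \<inter> pverts T. tree_le T r w u \<and> tree_le T r w v))) \<and>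
    (\<forall>u \<in> pverts T. \<forall>v \<in> pverts T. tree_le T r u v \<longrightarrow>
      (\<exists>H. strong_subgraph H D \<and> u \<in> pverts H \<and> v \<in> pverts H \<and>
        (\<forall>w \<in> pverts T. tree_le T r w u \<and> w \<noteq> u \<longrightarrow> w \<notin> pverts H)))"

definition ray_from :: "'a pair_pre_digraph \<Rightarrow> 'a \<Rightarrow> (nat \<Rightarrow> 'a) \<Rightarrow> bool" where
  "ray_from T r f \<longleftrightarrow> inj f \<and> f 0 = r \<and> (\<forall>n. (f n, f (Suc n)) \<in> parcs T)"

definition normal_tree :: "'a pair_pre_digraph \<Rightarrow> 'a pair_pre_digraph \<Rightarrow> 'a \<Rightarrow> bool" where
  "normal_tree D T r \<longleftrightarrow> weak_normal_tree D T r \<and>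
    (\<forall>f. ray_from T r f \<longrightarrow> (\<exists>N \<in> necklaces_in D. finite (range f - pverts N)))"

definition has_normal_spanning_tree :: "'a pair_pre_digraph \<Rightarrow> bool" where
  "has_normal_spanning_tree D \<longleftrightarrow> (\<exists>T r. normal_tree D T r \<and> pverts T = pverts D)"


section \<open>The space $|D|$\<close>

datatype 'a node = Vert 'a | End "'a pair_pre_digraph set"

definition nodes :: "'a pair_pre_digraph \<Rightarrow> 'a node set" where
  "nodes D = Vert ` pverts D \<union> End ` ends D"

fun limit_edge :: "'a pair_pre_digraph \<Rightarrow> 'a node \<Rightarrow> 'a node \<Rightarrow> bool" where
  "limit_edge D (Vert v) (End \<omega>) \<longleftrightarrow> v \<in> pverts D \<and> \<omega> \<in> ends D \<and>
    (\<forall>X. finite X \<and> X \<subseteq> pverts D - {v} \<longrightarrow> (\<exists>w \<in> verts (end_comp D X \<omega>). (v, w) \<in> parcs D))"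
| "limit_edge D (End \<omega>) (Vert v) \<longleftrightarrow> v \<in> pverts D \<and> \<omega> \<in> ends D \<and>
    (\<forall>X. finite X \<and> X \<subseteq> pverts D - {v} \<longrightarrow> (\<exists>w \<in> verts (end_comp D X \<omega>). (w, v) \<in> parcs D))"
| "limit_edge D (End \<omega>) (End \<eta>) \<longleftrightarrow> \<omega> \<in> ends D \<and> \<eta> \<in> ends D \<and> \<omega> \<noteq> \<eta> \<and>
    (\<forall>X. finite X \<and> X \<subseteq> pverts D \<and> end_comp D X \<omega> \<noteq> end_comp D X \<eta> \<longrightarrow>
      (\<exists>a \<in> verts (end_comp D X \<omega>). \<exists>b \<in> verts (end_comp D X \<eta>). (a, b) \<in> parcs D))"
| "limit_edge D (Vert u) (Vert v) \<longleftrightarrow> False"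

definition edges :: "'a pair_pre_digraph \<Rightarrow> ('a node \<times> 'a node) set" where
  "edges D = {(Vert u, Vert v) | u v. (u, v) \<in> parcs D} \<union> {(x, y). limit_edge D x y}"

text \<open>
  \<open>Inner x y t\<close> is the inner point \<open>(xy, t)\<close> of the edge or limit edge \<open>xy\<close>, at distance \<open>t\<close> from
  \<open>x\<close> and \<open>1 - t\<close> from \<open>y\<close>.
\<close>

datatype 'a point = Node "'a node" | Inner "'a node" "'a node" real

definition inner_points :: "'a pair_pre_digraph \<Rightarrow> 'a point set" where
  "inner_points D = {Inner x y t | x y t. (x, y) \<in> edges D \<and> 0 < t \<and> t < 1}"

definition points :: "'a pair_pre_digraph \<Rightarrow> 'a point set" where
  "points D = Node ` nodes D \<union> inner_points D"


section \<open>The topology DTop\<close>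

text \<open>
  The points of a star other than its centre are inner points, as they should be for radii at most
  1; a radius above 1 yields the same set as radius 1.
\<close>

definition uniform_star :: "'a pair_pre_digraph \<Rightarrow> 'a \<Rightarrow> real \<Rightarrow> 'a point set" where
  "uniform_star D v \<epsilon> = insert (Node (Vert v))
    {Inner x y t | x y t. Inner x y t \<in> inner_points D \<and>
      (x = Vert v \<and> t < \<epsilon> \<or> y = Vert v \<and> 1 - t < \<epsilon>)}"

definition edge_interval :: "'a \<Rightarrow> 'a \<Rightarrow> real \<Rightarrow> real \<Rightarrow> 'a point set" where
  "edge_interval u v a b = Inner (Vert u) (Vert v) ` {a<..<b}"

definition comp_nodes ::
    "'a pair_pre_digraph \<Rightarrow> 'a set \<Rightarrow> 'a pair_pre_digraph set \<Rightarrow> 'a node set" where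
  "comp_nodes D X \<omega> = Vert ` verts (end_comp D X \<omega>) \<union>
    End ` {\<eta> \<in> ends D. end_comp D X \<eta> = end_comp D X \<omega>}"

definition C_hat ::
    "'a pair_pre_digraph \<Rightarrow> real \<Rightarrow> 'a set \<Rightarrow> 'a pair_pre_digraph set \<Rightarrow> 'a point set" where
  "C_hat D \<epsilon> X \<omega> = Node ` comp_nodes D X \<omega> \<union>
    {Inner x y t | x y t. Inner x y t \<in> inner_points D \<and>
      (x \<in> comp_nodes D X \<omega> \<and> y \<in> comp_nodes D X \<omega> \<or>
       x \<in> comp_nodes D X \<omega> \<and> y \<notin> comp_nodes D X \<omega> \<and> t < \<epsilon> \<or>
       x \<notin> comp_nodes D X \<omega> \<and> y \<in> comp_nodes D X \<omega> \<and> 1 - t < \<epsilon>)}"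

fun near_nodes :: "'a pair_pre_digraph \<Rightarrow> 'a set \<Rightarrow> 'a node \<Rightarrow> 'a node set" where
  "near_nodes D X (Vert v) = {Vert v}"
| "near_nodes D X (End \<omega>) = comp_nodes D X \<omega>"

definition E_hat :: "'a pair_pre_digraph \<Rightarrow> real \<Rightarrow> 'a set \<Rightarrow> 'a node \<Rightarrow> 'a node \<Rightarrow> real
    \<Rightarrow> 'a point set" where
  "E_hat D \<epsilon> X x y t = {Inner a b s | a b s. Inner a b s \<in> inner_points D \<and>
    \<bar>s - t\<bar> < \<epsilon> \<and> a \<in> near_nodes D X x \<and> b \<in> near_nodes D X y}"

definition basic_opens :: "'a pair_pre_digraph \<Rightarrow> 'a point set set" where
  "basic_opens D =
    {uniform_star D v \<epsilon> | v \<epsilon>. v \<in> pverts D \<and> 0 < \<epsilon>} \<union>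
    {edge_interval u v a b | u v a b. (u, v) \<in> parcs D \<and> 0 \<le> a \<and> a < b \<and> b \<le> 1} \<union>
    {C_hat D \<epsilon> X \<omega> | \<epsilon> X \<omega>. \<omega> \<in> ends D \<and> finite X \<and> X \<subseteq> pverts D \<and> 0 < \<epsilon>} \<union>
    {E_hat D \<epsilon> X x y t | \<epsilon> X x y t. limit_edge D x y \<and> 0 < t \<and> t < 1 \<and> finite X \<and>
      X \<subseteq> pverts D \<and> {v. Vert v \<in> {x, y}} \<subseteq> X \<and> 0 < \<epsilon>}"

definition DTop :: "'a pair_pre_digraph \<Rightarrow> 'a point topology" where
  "DTop D = topology_generated_by (basic_opens D)"


section \<open>The role of strong connectedness\<close>

text \<open>
  A normal spanning tree forces the digraph to be strongly connected, whereas metrizability of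
  $|D|$ does not: the edgeless digraph on two vertices is a counterexample.
\<close>

lemma has_normal_spanning_tree_imp_strongly_connected:
  assumes "has_normal_spanning_tree D"
  shows "strongly_connected D"
proof -
  obtain T r where T: "normal_tree D T r" "pverts T = pverts D"
    using assms by (auto simp: has_normal_spanning_tree_def)
  then have W: "weak_normal_tree D T r" by (simp add: normal_tree_def)
  then have R: "rooted_tree T r" by (simp add: weak_normal_tree_def)
  then have r: "r \<in> pverts T" and scT: "strongly_connected T"
    by (auto simp: rooted_tree_def)
  have conn: "wf_digraph (with_proj D) \<and> r \<rightarrow>\<^sup>*\<^bsub>with_proj D\<^esub> v \<and> v \<rightarrow>\<^sup>*\<^bsub>with_proj D\<^esub> r" if v: "v \<in> pverts D" for v
  proof -
    interpret pair_bidirected_digraph T using R by (simp add: rooted_tree_def)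
    have "r \<rightarrow>\<^sup>*\<^bsub>with_proj T\<^esub> v"
      using scT r v T(2) by (auto simp: strongly_connected_def)
    then obtain p where p: "vpath p T" "hd p = r" "last p = v"
      using reachable_vpath_conv by blast
    then have "r \<in> set p" by (metis hd_in_set vpath_def vwalk_def)
    with p have "tree_le T r r v" by (auto simp: tree_le_def)
    then obtain H where H: "strong_subgraph H D" "r \<in> pverts H" "v \<in> pverts H"
      using W r v T(2) unfolding weak_normal_tree_def by metis
    then have sub: "subgraph H D" and "r \<rightarrow>\<^sup>*\<^bsub>with_proj H\<^esub> v" "v \<rightarrow>\<^sup>*\<^bsub>with_proj H\<^esub> r"
      by (auto simp: strong_subgraph_def strongly_connected_def)
    moreover have "wf_digraph (with_proj D)" using sub by (simp add: subgraph_def)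
    ultimately show ?thesis by (meson pre_digraph.reachable_mono)
  qed
  interpret wf_digraph "with_proj D"
    using conn r T(2) by simp
  show ?thesis
    using conn r T(2) by (auto simp: strongly_connected_def intro: reachable_trans)
qed

lemma metrizable_without_normal_spanning_tree:
  defines "D \<equiv> \<lparr>pverts = UNIV :: bool set, parcs = {}\<rparr>"
  shows "pair_wf_digraph D" and "metrizable_space (DTop D)" and "\<not> has_normal_spanning_tree D"
proof -
  show "pair_wf_digraph D" by unfold_locales (auto simp: D_def)
  have not_reach: "\<not> True \<rightarrow>\<^sup>*\<^bsub>with_proj D\<^esub> False"
  proof
    assume "True \<rightarrow>\<^sup>*\<^bsub>with_proj D\<^esub> False"
    then have "(True, False) \<in> (parcs D)\<^sup>*"
      by (metis reachable_def rtrancl_on_rtranclI with_proj_simps(3))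
    then show False by (simp add: D_def)
  qed
  then show "\<not> has_normal_spanning_tree D"
    using has_normal_spanning_tree_imp_strongly_connected[of D]
    by (auto simp: strongly_connected_def D_def)
  have "\<not> necklace N" for N :: "bool pair_pre_digraph"
  proof
    assume "necklace N"
    then obtain H :: "nat \<Rightarrow> bool pair_pre_digraph"
      where "\<forall>i j. pverts (H i) \<inter> pverts (H j) \<noteq> {} \<longleftrightarrow> \<bar>int i - int j\<bar> \<le> 1"
      unfolding necklace_def by (elim conjE exE)
    then have H: "pverts (H i) \<inter> pverts (H j) \<noteq> {} \<longleftrightarrow> \<bar>int i - int j\<bar> \<le> 1" for i j
      by (elim allE)
    have "pverts (H i) \<noteq> {}" for i using H[of i i] by simp
    then have "\<exists>x. x \<in> pverts (H i)" for i by blast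
    then obtain f where f: "\<And>i. f i \<in> pverts (H i)" by metis
    have ne: "f i \<noteq> f j" if "\<not> \<bar>int i - int j\<bar> \<le> 1" for i j
      using f[of i] f[of j] H[of i j] that by auto
    have "f 0 \<noteq> f 2" "f 0 \<noteq> f 4" "f 2 \<noteq> f 4" by (rule ne; simp)+
    then show False by metis
  qed
  then have ends: "ends D = {}" by (auto simp: ends_def necklaces_in_def quotient_def)
  have "limit_edge D x y \<longleftrightarrow> False" for x y
    by (cases "(D, x, y)" rule: limit_edge.cases) (auto simp: ends)
  then have inner: "inner_points D = {}" and lim: "\<And>x y. \<not> limit_edge D x y"
    by (auto simp: inner_points_def edges_def D_def)
  have star: "uniform_star D v \<epsilon> = {Node (Vert v)}" for v \<epsilon>
    by (simp add: uniform_star_def inner)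
  have arcs: "parcs D = {}" and verts: "pverts D = UNIV" by (simp_all add: D_def)
  have "basic_opens D = {{Node (Vert v)} | v \<epsilon>. (0::real) < \<epsilon>}"
    unfolding basic_opens_def star ends arcs verts by (simp add: lim)
  also have "\<dots> = {{Node (Vert v)} | v. True}"
    using gt_ex[of "0::real"] by auto
  finally have basic: "basic_opens D = {{Node (Vert v)} | v. True}" .
  have "topspace (DTop D) = range (\<lambda>v. Node (Vert v))"
    unfolding DTop_def topology_generated_by_topspace basic by auto
  moreover have "openin (DTop D) {Node (Vert v)}" for v
    unfolding DTop_def basic by (rule topology_generated_by_Basis) auto
  ultimately have "discrete_topology (range (\<lambda>v. Node (Vert v))) = DTop D"
    unfolding discrete_topology_unique by auto
  then show "metrizable_space (DTop D)" by (metis metrizable_space_discrete_topology)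
qed

end

theory Submission
  imports Defs
begin

text \<open>
  Both properties are equivalent to the existence of a \<^emph>\<open>centered rank\<close> \<open>\<rho>\<close>, a map from the vertices to
  the naturals such that every strongly connected subgraph has a unique vertex of least rank. The
  height in a normal spanning tree is centered; conversely, the vertices \<open>u\<close> of which \<open>v\<close> lies in
  the cone (the strong component of \<open>u\<close> among the vertices of rank at least \<open>\<rho> u\<close>) form a finite chain
  below \<open>v\<close>, and these chains are the root paths of a normal spanning tree, whose rays lie in
  necklaces because the cones along a ray have empty intersection.

  If \<open>|D|\<close> is metrizable, the vertices at distance at least \<open>1/n\<close> from all ends form countably many
  dispersed sets that cover the vertex set. Deleting finite strongly connected sets that are linked
  to each other, always through a vertex of the first dispersed set still present, reaches every
  vertex after finitely many steps, since otherwise the deleted sets would form a necklace towards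
  an end in the closure of one dispersed set. Counting the deleted vertices gives a centered rank.

  Conversely, for a centered rank the cones containing an end form a neighbourhood base of it. The
  supremum metric of the coordinate functions of cones, of stars and of bumps over edges between
  two of these sets, scaled by \<open>(1/2) ^ \<rho>\<close>, then induces DTop.
\<close>

section \<open>Strongly connected sets\<close>

text \<open>One value of a centered rank may be shared by infinitely many vertices, so the
  coordinate functions of one rank may form an infinite family. Hence the metric is a supremum, and
  continuity of each function is not enough: one neighbourhood must control all functions of rank at
  most \<open>N\<close> at once. It does, because a cone of rank above \<open>N\<close> is contained
  in or disjoint from every node set that such a function uses, and so acts as a single node.
  Functions of larger rank are small by their weight. In the other direction the difficulty is that
  the deletion process branches. All its choices depend on the current component only, so the
  vertices of a strongly connected set share their history until the first of them is deleted. Those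
  deleted first have the same number of earlier deletions and differ by an enumeration of one finite
  set; the others get larger ranks. The deleted sets are linked because only a chain of overlapping
  finite strong sets is a necklace, and only a necklace yields an end that contradicts
  dispersedness.\<close>

definition strong_set :: "'a rel \<Rightarrow> 'a set \<Rightarrow> bool" where
  "strong_set E S \<longleftrightarrow> S \<noteq> {} \<and> (\<forall>u\<in>S. \<forall>v\<in>S. (u, v) \<in> rtrancl_on S E)"

text \<open>The vertex set of the strong component of \<open>v\<close> in the subgraph induced on
  \<open>A\<close>; it is empty if \<open>v\<close> lies outside \<open>A\<close>.\<close>

definition strong_class :: "'a rel \<Rightarrow> 'a set \<Rightarrow> 'a \<Rightarrow> 'a set" where
  "strong_class E A v = {w. (v, w) \<in> rtrancl_on A E \<and> (w, v) \<in> rtrancl_on A E}"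

lemma rtrancl_on_mono_set:
  assumes "(u, v) \<in> rtrancl_on A E" "A \<subseteq> B"
  shows "(u, v) \<in> rtrancl_on B E"
  by (rule rtrancl_on_mono[OF subset_refl assms(2,1)])

lemma strong_class_subset: "strong_class E A v \<subseteq> A"
  by (auto simp: strong_class_def dest: in_rtrancl_on_in_F)

lemma strong_class_self: "v \<in> A \<Longrightarrow> v \<in> strong_class E A v"
  by (auto simp: strong_class_def)

lemma strong_class_base: "w \<in> strong_class E A v \<Longrightarrow> v \<in> A"
  by (auto simp: strong_class_def dest: in_rtrancl_on_in_F)

lemma strong_class_eq: "w \<in> strong_class E A v \<Longrightarrow> strong_class E A w = strong_class E A v"
  by (auto simp: strong_class_def intro: rtrancl_on_trans)

lemma strong_set_strong_class:
  assumes "v \<in> A"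
  shows "strong_set E (strong_class E A v)"
proof -
  let ?C = "strong_class E A v"
  \<comment> \<open>Carrying the way back to \<open>v\<close> as a premise puts every intermediate
    vertex of the walk into the class.\<close>
  have "(w, v) \<in> rtrancl_on A E \<longrightarrow> (u, w) \<in> rtrancl_on ?C E"
    if "(u, w) \<in> rtrancl_on A E" "u \<in> ?C" for u w
    using that
  proof (induction rule: rtrancl_on_induct)
    case base
    then show ?case by auto
  next
    case (step y z)
    show ?case
    proof
      assume z: "(z, v) \<in> rtrancl_on A E"
      then have "(y, v) \<in> rtrancl_on A E"
        using step converse_rtrancl_on_into_rtrancl_on by metis
      then have "(u, y) \<in> rtrancl_on ?C E" using step by blast
      moreover have "z \<in> ?C"
        using z step rtrancl_on_into_rtrancl_on[of u y A E z]
        by (auto simp: strong_class_def intro: rtrancl_on_trans)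
      ultimately show "(u, z) \<in> rtrancl_on ?C E"
        using step by (auto intro: rtrancl_on_into_rtrancl_on)
    qed
  qed
  moreover have "(u, w) \<in> rtrancl_on A E" if "u \<in> ?C" "w \<in> ?C" for u w
    using that by (auto simp: strong_class_def intro: rtrancl_on_trans)
  ultimately show ?thesis
    using strong_class_self[OF assms, of E]
    unfolding strong_set_def by (metis (mono_tags, lifting) empty_iff mem_Collect_eq strong_class_def)
qed

lemma strong_set_subset_class:
  assumes "strong_set E S" "S \<subseteq> A" "v \<in> S"
  shows "S \<subseteq> strong_class E A v"
  using assms by (auto simp: strong_set_def strong_class_def intro: rtrancl_on_mono_set)

lemma strong_set_subset_class':
  assumes "strong_set E S" "S \<subseteq> A" "w \<in> S" "w \<in> strong_class E A v"
  shows "S \<subseteq> strong_class E A v"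
  using strong_set_subset_class[OF assms(1-3)] strong_class_eq[OF assms(4)] by simp

lemma strong_set_singleton: "strong_set E {v}"
  by (auto simp: strong_set_def)

lemma strong_set_Un:
  assumes "strong_set E S" "strong_set E T" "S \<inter> T \<noteq> {}"
  shows "strong_set E (S \<union> T)"
proof -
  obtain x where x: "x \<in> S" "x \<in> T" using assms by blast
  have "(u, x) \<in> rtrancl_on (S \<union> T) E \<and> (x, u) \<in> rtrancl_on (S \<union> T) E" if "u \<in> S \<union> T" for u
    using that x assms unfolding strong_set_def
    by (metis Un_iff rtrancl_on_mono_set sup_ge1 sup_ge2)
  then show ?thesis
    using x unfolding strong_set_def by (metis Un_iff empty_iff rtrancl_on_trans)
qed

text \<open>Two vertices of the union already lie in a finite partial union, which is strong by
  gluing along shared vertices.\<close>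

lemma strong_set_UN_chain:
  assumes strong: "\<And>n. strong_set E (H n)" and meet: "\<And>n. H n \<inter> H (Suc n) \<noteq> {}"
  shows "strong_set E (\<Union>n. H n)"
proof -
  have part: "strong_set E (\<Union>k\<le>n. H k)" for n
  proof (induction n)
    case (Suc n)
    have "strong_set E ((\<Union>k\<le>n. H k) \<union> H (Suc n))"
      using Suc strong meet[of n] by (intro strong_set_Un) auto
    then show ?case by (simp add: atMost_Suc Un_commute)
  qed (use strong in auto)
  have "(u, v) \<in> rtrancl_on (\<Union>n. H n) E" if "u \<in> H m" "v \<in> H k" for u v m k
  proof -
    have "u \<in> (\<Union>j\<le>max m k. H j)" "v \<in> (\<Union>j\<le>max m k. H j)" using that by force+
    then have "(u, v) \<in> rtrancl_on (\<Union>j\<le>max m k. H j) E"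
      using part unfolding strong_set_def by blast
    then show ?thesis by (rule rtrancl_on_mono_set) auto
  qed
  moreover have "(\<Union>n. H n) \<noteq> {}" using strong[of 0] by (auto simp: strong_set_def)
  ultimately show ?thesis unfolding strong_set_def by blast
qed

text \<open>Every vertex of \<open>K\<close> lies on a route from \<open>u\<close> to
  \<open>v\<close> inside \<open>K\<close>; this makes the union of a set for \<open>u\<close>,
  \<open>v\<close> and a set for \<open>v\<close>, \<open>u\<close> strong.\<close>

lemma rtrancl_on_finite_support:
  assumes "(u, v) \<in> rtrancl_on A E"
  shows "\<exists>K. finite K \<and> K \<subseteq> A \<and> (\<forall>w\<in>K. (u, w) \<in> rtrancl_on K E \<and> (w, v) \<in> rtrancl_on K E) \<and> u \<in> K \<and> v \<in> K"
  using assms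
proof (induction rule: rtrancl_on_induct)
  case base
  then show ?case by (intro exI[of _ "{u}"]) auto
next
  case (step y z)
  then obtain K where K: "finite K" "K \<subseteq> A" "u \<in> K" "y \<in> K"
    "\<And>w. w \<in> K \<Longrightarrow> (u, w) \<in> rtrancl_on K E \<and> (w, y) \<in> rtrancl_on K E" by blast
  let ?K = "insert z K"
  have 1: "(u, w) \<in> rtrancl_on ?K E \<and> (w, y) \<in> rtrancl_on ?K E" if "w \<in> K" for w
    using K(5)[OF that] by (meson rtrancl_on_mono_set subset_insertI)
  have 2: "(y, z) \<in> rtrancl_on ?K E"
    using step K by (auto intro: rtrancl_on_into_rtrancl_on)
  have "(u, w) \<in> rtrancl_on ?K E \<and> (w, z) \<in> rtrancl_on ?K E" if "w \<in> ?K" for w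
    using that 1 2 K(4) by (auto intro: rtrancl_on_trans)
  then show ?case using K step by (intro exI[of _ ?K]) auto
qed

lemma strong_set_finite_pair:
  assumes "strong_set E S" "u \<in> S" "v \<in> S"
  shows "\<exists>K. finite K \<and> K \<subseteq> S \<and> strong_set E K \<and> u \<in> K \<and> v \<in> K"
proof -
  obtain K where K: "finite K" "K \<subseteq> S" "u \<in> K" "v \<in> K"
    "\<And>w. w \<in> K \<Longrightarrow> (u, w) \<in> rtrancl_on K E \<and> (w, v) \<in> rtrancl_on K E"
    using rtrancl_on_finite_support[of u v S E] assms unfolding strong_set_def by metis
  obtain L where L: "finite L" "L \<subseteq> S" "v \<in> L" "u \<in> L"
    "\<And>w. w \<in> L \<Longrightarrow> (v, w) \<in> rtrancl_on L E \<and> (w, u) \<in> rtrancl_on L E"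
    using rtrancl_on_finite_support[of v u S E] assms unfolding strong_set_def by metis
  have KL: "(a, b) \<in> rtrancl_on (K \<union> L) E" if "(a, b) \<in> rtrancl_on K E \<or> (a, b) \<in> rtrancl_on L E" for a b
    using that by (auto intro: rtrancl_on_mono_set)
  have "(u, w) \<in> rtrancl_on (K \<union> L) E \<and> (w, u) \<in> rtrancl_on (K \<union> L) E" if "w \<in> K \<union> L" for w
    using that K(3-5) L(3-5) KL by (metis Un_iff rtrancl_on_trans)
  then have "strong_set E (K \<union> L)"
    using K(3) unfolding strong_set_def by (metis Un_iff empty_iff rtrancl_on_trans)
  then show ?thesis using K L by (intro exI[of _ "K \<union> L"]) auto
qed

lemma strong_set_finite_subset:
  assumes "strong_set E S" "finite F" "F \<noteq> {}" "F \<subseteq> S"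
  shows "\<exists>K. finite K \<and> F \<subseteq> K \<and> K \<subseteq> S \<and> strong_set E K"
  using assms(2-4)
proof (induction rule: finite_ne_induct)
  case (singleton x)
  then show ?case by (intro exI[of _ "{x}"]) (auto simp: strong_set_singleton)
next
  case (insert x F)
  then obtain K where K: "finite K" "F \<subseteq> K" "K \<subseteq> S" "strong_set E K" by auto
  then obtain y where y: "y \<in> K" using insert by blast
  then obtain L where L: "finite L" "L \<subseteq> S" "strong_set E L" "x \<in> L" "y \<in> L"
    using strong_set_finite_pair[OF assms(1), of x y] insert K by blast
  have "strong_set E (K \<union> L)" using K L y by (intro strong_set_Un) auto
  then show ?case using K L by (intro exI[of _ "K \<union> L"]) auto
qed

lemma reachable_iff_rtrancl_on: "u \<rightarrow>\<^sup>*\<^bsub>with_proj H\<^esub> v \<longleftrightarrow> (u, v) \<in> rtrancl_on (pverts H) (parcs H)"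
  by (simp add: reachable_def)

lemma strongly_connected_iff_strong_set:
  "strongly_connected (with_proj H) \<longleftrightarrow> strong_set (parcs H) (pverts H)"
  by (simp add: strongly_connected_def strong_set_def reachable_def)

lemma rtrancl_on_Int:
  "rtrancl_on A (E \<inter> A \<times> A) = rtrancl_on A E"
proof -
  have "(u, v) \<in> rtrancl_on A (E \<inter> A \<times> A)" if "(u, v) \<in> rtrancl_on A E" for u v
    using that by (induction rule: rtrancl_on_induct) (auto intro: rtrancl_on_into_rtrancl_on)
  moreover have "(u, v) \<in> rtrancl_on A E" if "(u, v) \<in> rtrancl_on A (E \<inter> A \<times> A)" for u v
    using that by (induction rule: rtrancl_on_induct) (auto intro: rtrancl_on_into_rtrancl_on)
  ultimately show ?thesis by auto
qed

lemma strong_set_mono_rel: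
  assumes "strong_set E S" "E \<subseteq> E'"
  shows "strong_set E' S"
  using assms rtrancl_on_mono[OF assms(2) subset_refl] by (auto simp: strong_set_def)

definition induced :: "'a pair_pre_digraph \<Rightarrow> 'a set \<Rightarrow> 'a pair_pre_digraph" where
  "induced D S = \<lparr>pverts = S, parcs = parcs D \<inter> S \<times> S\<rparr>"

lemma induced_simps [simp]: "pverts (induced D S) = S" "parcs (induced D S) = parcs D \<inter> S \<times> S"
  by (simp_all add: induced_def)

lemma pair_subgraph_iff:
  "subgraph (with_proj H) (with_proj D) \<longleftrightarrow> pverts H \<subseteq> pverts D \<and> parcs H \<subseteq> parcs D \<and>
    pair_wf_digraph D \<and> pair_wf_digraph H"
  by (auto simp: subgraph_def wf_digraph_wp_iff)

lemma strong_subgraph_imp_strong_set: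
  assumes "strong_subgraph H D"
  shows "strong_set (parcs D) (pverts H)" "pverts H \<subseteq> pverts D"
  using assms strong_set_mono_rel
  by (auto simp: strong_subgraph_def strongly_connected_iff_strong_set pair_subgraph_iff)

lemma pair_wf_digraph_induced: "pair_wf_digraph (induced D S)"
  by unfold_locales auto

lemma strong_set_induced [simp]: "strong_set (parcs D \<inter> S \<times> S) S \<longleftrightarrow> strong_set (parcs D) S"
  by (simp add: strong_set_def rtrancl_on_Int)

text \<open>Together with \<open>strong_subgraph_imp_strong_set\<close> this lets vertex sets stand
  for subgraphs: adding all arcs of \<open>D\<close> between its vertices keeps a subgraph
  strong.\<close>

lemma strong_subgraph_induced:
  assumes "strong_set (parcs D) S" "S \<subseteq> pverts D" "pair_wf_digraph D"
  shows "strong_subgraph (induced D S) D"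
  using assms
  by (auto simp: strong_subgraph_def strongly_connected_iff_strong_set pair_subgraph_iff
      pair_wf_digraph_induced)

section \<open>Necklaces\<close>

lemma necklace_of_chain:
  assumes wf: "pair_wf_digraph D"
    and K: "\<And>n. finite (K n)" "\<And>n. K n \<subseteq> pverts D" "\<And>n. strong_set (parcs D) (K n)"
    and meet: "\<And>n. K n \<inter> K (Suc n) \<noteq> {}"
    and disj: "\<And>i j. i + 2 \<le> j \<Longrightarrow> K i \<inter> K j = {}"
  shows "\<exists>N \<in> necklaces_in D. pverts N = (\<Union>n. K n)"
proof -
  \<comment> \<open>Arcs of \<open>D\<close> between different beads are left out, since every arc
    of a necklace lies in a bead.\<close>
  define N where "N = \<lparr>pverts = (\<Union>n. K n), parcs = (\<Union>n. parcs D \<inter> K n \<times> K n)\<rparr>"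
  have N: "pverts N = (\<Union>n. K n)" "parcs N = (\<Union>n. parcs D \<inter> K n \<times> K n)"
    by (simp_all add: N_def)
  have wfN: "pair_wf_digraph N" by unfold_locales (auto simp: N)
  have "strong_set (parcs N) (K n)" for n
    using K(3)[of n] strong_set_mono_rel[of "parcs D \<inter> K n \<times> K n" "K n" "parcs N"]
    by (auto simp: N)
  then have "strong_set (parcs N) (pverts N)"
    unfolding N(1) by (intro strong_set_UN_chain) (use meet in auto)
  then have sc: "strongly_connected N" by (simp add: strongly_connected_iff_strong_set)
  have "pair_fin_digraph (induced D (K n))" for n
    using K(1)[of n] pair_wf_digraph_induced[of D "K n"]
    by (auto simp: pair_fin_digraph_def pair_fin_digraph_axioms_def)
  moreover have "strong_subgraph (induced D (K n)) N" for n
    using K(3)[of n] wfN pair_wf_digraph_induced[of D "K n"]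
    by (auto simp: strong_subgraph_def strongly_connected_iff_strong_set pair_subgraph_iff N)
  moreover have "K i \<inter> K j \<noteq> {} \<longleftrightarrow> \<bar>int i - int j\<bar> \<le> 1" for i j
  proof
    assume "K i \<inter> K j \<noteq> {}"
    then have "\<not> i + 2 \<le> j" "\<not> j + 2 \<le> i" using disj[of i j] disj[of j i] by auto
    then show "\<bar>int i - int j\<bar> \<le> 1" by linarith
  next
    assume "\<bar>int i - int j\<bar> \<le> 1"
    then have "i = j \<or> j = Suc i \<or> i = Suc j" by linarith
    then show "K i \<inter> K j \<noteq> {}"
      using meet[of i] meet[of j] by auto
  qed
  ultimately have "necklace N"
    unfolding necklace_def using sc
    by (intro conjI exI[of _ "\<lambda>n. induced D (K n)"]) (auto simp: N)
  moreover have "subgraph N D"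
    using K(2) wf wfN by (auto simp: pair_subgraph_iff N)
  ultimately show ?thesis using N(1) by (auto simp: necklaces_in_def)
qed

lemma necklaceE:
  assumes "necklace N"
  obtains H where "\<And>n::nat. finite (H n)" "\<And>n. strong_set (parcs N) (H n)" "pverts N = (\<Union>n. H n)"
    "\<And>n. H n \<inter> H (Suc n) \<noteq> {}" "\<And>i j. i + 2 \<le> j \<Longrightarrow> H i \<inter> H j = {}"
proof -
  obtain H where H: "\<And>n::nat. pair_fin_digraph (H n)" "\<And>n. strong_subgraph (H n) N"
    "pverts N = (\<Union>n. pverts (H n))"
    "\<And>i j. pverts (H i) \<inter> pverts (H j) \<noteq> {} \<longleftrightarrow> \<bar>int i - int j\<bar> \<le> 1"
    using assms unfolding necklace_def by metis
  show ?thesis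
  proof (rule that[of "\<lambda>n. pverts (H n)"])
    show "finite (pverts (H n))" for n using H(1) by (rule pair_fin_digraph.pair_finite_verts)
    show "strong_set (parcs N) (pverts (H n))" for n
      using H(2) by (rule strong_subgraph_imp_strong_set)
    show "pverts (H n) \<inter> pverts (H (Suc n)) \<noteq> {}" for n by (subst H(4)) simp
    show "pverts (H i) \<inter> pverts (H j) = {}" if "i + 2 \<le> j" for i j
      using H(4)[of i j] that by auto
  qed (rule H(3))
qed

lemma necklace_infinite:
  assumes "necklace N"
  shows "infinite (pverts N)"
proof -
  obtain H where H: "\<And>n::nat. finite (H n)" "\<And>n. strong_set (parcs N) (H n)" "pverts N = (\<Union>n. H n)"
    "\<And>n. H n \<inter> H (Suc n) \<noteq> {}" "\<And>i j. i + 2 \<le> j \<Longrightarrow> H i \<inter> H j = {}"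
    using necklaceE[OF assms] by metis
  have "\<exists>x. x \<in> H n" for n using H(4)[of n] by blast
  then obtain f where f: "\<And>n. f n \<in> H n" by metis
  \<comment> \<open>Beads of different even index are disjoint.\<close>
  have "inj (\<lambda>n. f (2 * n))"
  proof (rule linorder_inj_onI)
    fix i j :: nat assume "i < j"
    then show "f (2 * i) \<noteq> f (2 * j)" using H(5)[of "2 * i" "2 * j"] f by fastforce
  qed auto
  then have "infinite (range (\<lambda>n. f (2 * n)))" by (rule range_inj_infinite)
  moreover have "range (\<lambda>n. f (2 * n)) \<subseteq> pverts N" using f H(3) by blast
  ultimately show ?thesis using finite_subset by blast
qed

text \<open>Every vertex lies in at most two beads, so a finite set meets only finitely many of them.\<close>

lemma necklace_tail:
  assumes "necklace N" "finite X"
  shows "\<exists>S. S \<subseteq> pverts N - X \<and> strong_set (parcs N) S \<and> finite (pverts N - S)"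
proof -
  obtain H where H: "\<And>n::nat. finite (H n)" "\<And>n. strong_set (parcs N) (H n)" "pverts N = (\<Union>n. H n)"
    "\<And>n. H n \<inter> H (Suc n) \<noteq> {}" "\<And>i j. i + 2 \<le> j \<Longrightarrow> H i \<inter> H j = {}"
    using necklaceE[OF assms(1)] by metis
  have "\<exists>m. \<forall>n\<ge>m. H n \<inter> X = {}"
    using assms(2)
  proof (induction X rule: finite_induct)
    case (insert x X)
    then obtain m where m: "\<forall>n\<ge>m. H n \<inter> X = {}" by blast
    have "\<exists>k. \<forall>n\<ge>k. x \<notin> H n"
    proof (cases "\<exists>i. x \<in> H i")
      case True
      then obtain i where "x \<in> H i" by blast
      then show ?thesis using H(5)[of i] by (intro exI[of _ "i + 2"]) blast
    qed auto
    then obtain k where "\<forall>n\<ge>k. x \<notin> H n" by blast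
    then show ?case using m by (intro exI[of _ "max m k"]) auto
  qed auto
  then obtain m where m: "\<And>n. n \<ge> m \<Longrightarrow> H n \<inter> X = {}" by blast
  let ?S = "\<Union>n. H (m + n)"
  have "strong_set (parcs N) ?S"
    using H(2,4) by (intro strong_set_UN_chain) auto
  moreover have "?S \<subseteq> pverts N - X"
  proof
    fix x assume "x \<in> ?S"
    then obtain n where "x \<in> H (m + n)" by blast
    then show "x \<in> pverts N - X" using m[of "m + n"] H(3) by auto
  qed
  moreover have "pverts N - ?S \<subseteq> (\<Union>n<m. H n)"
  proof
    fix x assume x: "x \<in> pverts N - ?S"
    then obtain n where n: "x \<in> H n" using H(3) by blast
    moreover have "x \<notin> H (m + (n - m))" using x by blast
    ultimately have "n < m" by (cases "n < m") auto
    then show "x \<in> (\<Union>n<m. H n)" using n by blast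
  qed
  then have "finite (pverts N - ?S)" using H(1) by (meson finite_UN finite_lessThan finite_subset)
  ultimately show ?thesis by blast
qed

section \<open>Ends\<close>

lemma vwalk_imp_rtrancl_on:
  assumes "vwalk p (with_proj D)" "set p \<subseteq> A"
  shows "(hd p, last p) \<in> rtrancl_on A (parcs D)"
  using assms
proof (induction p rule: vwalk_arcs.induct)
  case (3 x y xs)
  then have "vwalk (y # xs) (with_proj D)" "(x, y) \<in> parcs D" "x \<in> A" by (auto simp: vwalk_def)
  then show ?case
    using 3 converse_rtrancl_on_into_rtrancl_on[of x y "parcs D" "last (y # xs)" A] by auto
qed (auto simp: vwalk_def)

lemma rtrancl_on_imp_vpath:
  assumes "(u, v) \<in> rtrancl_on A (parcs D)" "A \<subseteq> pverts D"
  obtains p where "vpath p (with_proj D)" "set p \<subseteq> A" "hd p = u" "last p = v"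
proof -
  interpret I: wf_digraph "with_proj (induced D A)"
    by (simp add: wf_digraph_wp_iff pair_wf_digraph_induced)
  have "u \<rightarrow>\<^sup>*\<^bsub>with_proj (induced D A)\<^esub> v"
    using assms(1) by (simp add: reachable_iff_rtrancl_on rtrancl_on_Int)
  then obtain p where "vpath p (with_proj (induced D A))" "hd p = u" "last p = v"
    using I.reachable_vpath_conv by blast
  then show ?thesis
    using assms(2) that[of p] by (auto simp: vpath_def vwalk_def)
qed

text \<open>A shortest path from \<open>B\<close> to \<open>C\<close> inside \<open>A\<close> meets
  both sets only in its endpoints, for otherwise it could be cut.\<close>

lemma ex_set_path:
  assumes "(u, v) \<in> rtrancl_on A (parcs D)" "A \<subseteq> pverts D" "u \<in> B" "v \<in> C"
  obtains p where "set_path D B C p" "set p \<subseteq> A"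
proof -
  let ?Q = "\<lambda>p. vpath p (with_proj D) \<and> set p \<subseteq> A \<and> hd p \<in> B \<and> last p \<in> C"
  obtain p0 where "?Q p0" using rtrancl_on_imp_vpath[OF assms(1,2)] assms(3,4) by metis
  then obtain p where p: "?Q p" and min: "\<And>q. ?Q q \<Longrightarrow> length p \<le> length q"
    by (metis (no_types, lifting) ex_has_least_nat[of ?Q p0 length])
  then have ne: "p \<noteq> []" by (auto simp: vpath_def vwalk_def)
  have "x = hd p" if "x \<in> set p" "x \<in> B" for x
  proof (rule ccontr)
    assume x: "x \<noteq> hd p"
    obtain ys zs where ys: "p = ys @ x # zs" using \<open>x \<in> set p\<close> by (meson split_list)
    with x have "ys \<noteq> []" by auto
    moreover have "?Q (x # zs)"
      using p that vwalkI_append_r[of "x # zs" ys "with_proj D"] unfolding ys by (auto simp: vpath_def)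
    ultimately show False using min[of "x # zs"] ys by auto
  qed
  moreover have "x = last p" if "x \<in> set p" "x \<in> C" for x
  proof (rule ccontr)
    assume x: "x \<noteq> last p"
    obtain ys zs where ys: "p = ys @ x # zs" using \<open>x \<in> set p\<close> by (meson split_list)
    with x have "zs \<noteq> []" by auto
    moreover have "?Q (ys @ [x])"
      using p that vwalkI_append_l[of "ys @ [x]" zs "with_proj D"] unfolding ys
      by (auto simp: vpath_def hd_append)
    ultimately show False using min[of "ys @ [x]"] ys by auto
  qed
  ultimately have "set_path D B C p"
    using p ne unfolding set_path_def by auto
  then show ?thesis using that p by blast
qed

text \<open>Greedy choice: each new path avoids the finitely many vertices of the earlier ones.
  Nonempty disjoint paths are distinct, hence the family is infinite.\<close>

lemma infinite_disjoint_familyI: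
  assumes avoid: "\<And>X. finite X \<Longrightarrow> \<exists>p. Q p \<and> set p \<inter> X = {}" and ne: "\<And>p. Q p \<Longrightarrow> p \<noteq> []"
  shows "\<exists>P. infinite P \<and> (\<forall>p\<in>P. Q p) \<and> pairwise (\<lambda>p q. set p \<inter> set q = {}) P"
proof -
  have "\<exists>f. \<forall>n::nat. Q (f n) \<and> set (f n) \<inter> (\<Union>i<n. set (f i)) = {}"
    by (rule dependent_wf_choice[of less_than]) (use avoid in auto)
  then obtain f where f: "\<And>n::nat. Q (f n)" "\<And>n. set (f n) \<inter> (\<Union>i<n. set (f i)) = {}" by blast
  have disj: "set (f i) \<inter> set (f j) = {}" if "i < j" for i j using f(2)[of j] that by blast
  have "inj f"
  proof (rule linorder_inj_onI)
    fix i j :: nat assume "i < j"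
    then show "f i \<noteq> f j" using disj[of i j] ne[OF f(1)[of i]] by auto
  qed auto
  then have "infinite (range f)" by (rule range_inj_infinite)
  moreover have "pairwise (\<lambda>p q. set p \<inter> set q = {}) (range f)"
  proof (rule pairwiseI)
    fix p q assume "p \<in> range f" "q \<in> range f" "p \<noteq> q"
    then obtain i j where "p = f i" "q = f j" "i \<noteq> j" by blast
    then show "set p \<inter> set q = {}" using disj[of i j] disj[of j i] by (cases "i < j") auto
  qed
  ultimately show ?thesis using f(1) by blast
qed

text \<open>Each vertex of \<open>Y\<close> lies on at most one member of the family.\<close>

lemma infinite_disjoint_family_avoid:
  assumes "infinite P" "pairwise (\<lambda>p q. set p \<inter> set q = {}) P" "finite Y"
  shows "\<exists>p\<in>P. set p \<inter> Y = {}"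
proof (rule ccontr)
  assume "\<not> ?thesis"
  then have "\<forall>p\<in>P. \<exists>x. x \<in> set p \<inter> Y" by blast
  then obtain g where g: "\<And>p. p \<in> P \<Longrightarrow> g p \<in> set p \<inter> Y" by metis
  have "inj_on g P"
  proof (rule inj_onI)
    fix p q assume "p \<in> P" "q \<in> P" "g p = g q"
    then show "p = q" using g[of p] g[of q] assms(2) unfolding pairwise_def by (metis IntE disjoint_iff)
  qed
  moreover have "g ` P \<subseteq> Y" using g by blast
  ultimately show False using assms by (meson finite_subset inj_on_finite)
qed

text \<open>The bridge from the library's components, on which \<open>end_comp\<close> rests, to
  \<open>strong_class\<close>.\<close>

lemma sccs_restrict:
  "pre_digraph.sccs (with_proj D \<restriction> A) = (\<lambda>v. with_proj (induced D (strong_class (parcs D) A v))) ` A"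
proof -
  let ?G = "with_proj D \<restriction> A"
  interpret I: wf_digraph ?G
    by unfold_locales (auto simp: induce_subgraph_def)
  have ends: "arcs_ends ?G = parcs D \<inter> A \<times> A"
    by (force simp: induce_subgraph_def arcs_ends_def arc_to_ends_def)
  have reach: "u \<rightarrow>\<^sup>*\<^bsub>?G\<^esub> v \<longleftrightarrow> (u, v) \<in> rtrancl_on A (parcs D)" for u v
    unfolding reachable_def ends by (simp add: rtrancl_on_Int)
  have "I.sccs_verts = strong_class (parcs D) A ` A"
  proof (intro set_eqI iffI)
    fix S assume S: "S \<in> I.sccs_verts"
    then obtain v where v: "v \<in> S" by (auto simp: I.sccs_verts_def)
    have "S = strong_class (parcs D) A v"
      using S v unfolding I.sccs_verts_def strong_class_def reach by blast
    moreover have "v \<in> A"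
      using calculation v strong_class_subset by fastforce
    ultimately show "S \<in> strong_class (parcs D) A ` A" by blast
  next
    fix S assume "S \<in> strong_class (parcs D) A ` A"
    then obtain v where v: "v \<in> A" "S = strong_class (parcs D) A v" by blast
    then show "S \<in> I.sccs_verts"
      using strong_class_self[of v A "parcs D"]
      unfolding I.sccs_verts_def strong_class_def reach
      by (auto intro: rtrancl_on_trans)
  qed
  then have "I.sccs = (\<lambda>v. ?G \<restriction> strong_class (parcs D) A v) ` A"
    by (simp add: I.sccs_conv_sccs_verts image_image)
  moreover have "?G \<restriction> strong_class (parcs D) A v = with_proj (induced D (strong_class (parcs D) A v))" for v
    using strong_class_subset[of "parcs D" A v]
    by (auto simp: induce_subgraph_def with_proj_def)
  ultimately show ?thesis by simp
qed

text \<open>If \<open>S\<close> is a strong component left by deleting a finite set, this says that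
  the end lives in \<open>S\<close>; see \<open>end_verts_eq_class_iff\<close>.\<close>

definition eventually_in :: "'a pair_pre_digraph set \<Rightarrow> 'a set \<Rightarrow> bool" where
  "eventually_in \<omega> S \<longleftrightarrow> (\<forall>N\<in>\<omega>. finite (pverts N - S))"

abbreviation end_verts :: "'a pair_pre_digraph \<Rightarrow> 'a set \<Rightarrow> 'a pair_pre_digraph set \<Rightarrow> 'a set" where
  "end_verts D X \<omega> \<equiv> verts (end_comp D X \<omega>)"

section \<open>Ends seen through strong components\<close>

locale wf_pair_digraph =
  fixes D :: "'a pair_pre_digraph"
  assumes wf_D: "pair_wf_digraph D"
begin

abbreviation "V \<equiv> pverts D"
abbreviation "E \<equiv> parcs D"

text \<open>A tail of the necklace that avoids \<open>X\<close> is strong, so it lies within one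
  component.\<close>

lemma necklace_class:
  assumes "N \<in> necklaces_in D" "finite X"
  shows "\<exists>v \<in> V - X. finite (pverts N - strong_class E (V - X) v)"
proof -
  have N: "necklace N" "pverts N \<subseteq> V" "parcs N \<subseteq> E"
    using assms by (auto simp: necklaces_in_def pair_subgraph_iff)
  obtain S where S: "S \<subseteq> pverts N - X" "strong_set (parcs N) S" "finite (pverts N - S)"
    using necklace_tail[OF N(1) assms(2)] by blast
  then obtain v where v: "v \<in> S" by (auto simp: strong_set_def)
  have "S \<subseteq> strong_class E (V - X) v"
    using S N v by (intro strong_set_subset_class strong_set_mono_rel[OF S(2)]) auto
  then have "finite (pverts N - strong_class E (V - X) v)"
    using S(3) by (meson Diff_mono finite_subset subset_refl)
  then show ?thesis using v S N by blast
qed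

lemma necklace_meets:
  assumes "N \<in> necklaces_in D" "finite (pverts N - S)" "finite (pverts N - S')"
  shows "S \<inter> S' \<inter> pverts N \<noteq> {}"
proof
  assume "S \<inter> S' \<inter> pverts N = {}"
  then have "pverts N \<subseteq> (pverts N - S) \<union> (pverts N - S')" by blast
  then show False
    using assms necklace_infinite[of N] finite_subset by (auto simp: necklaces_in_def)
qed

lemma inf_disjoint_paths_reach:
  assumes "inf_disjoint_paths D N1 N2" "finite X"
    and "finite (pverts N1 - strong_class E (V - X) v)" "finite (pverts N2 - strong_class E (V - X) w)"
  shows "(v, w) \<in> rtrancl_on (V - X) E"
proof -
  \<comment> \<open>Besides \<open>X\<close> the path has to avoid the finite parts of both
    necklaces outside their components; then it starts in the component of \<open>v\<close> and ends
    in that of \<open>w\<close>.\<close>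
  let ?Y = "X \<union> (pverts N1 - strong_class E (V - X) v) \<union> (pverts N2 - strong_class E (V - X) w)"
  obtain P where P: "infinite P" "\<And>p. p \<in> P \<Longrightarrow> set_path D (pverts N1) (pverts N2) p"
    "pairwise (\<lambda>p q. set p \<inter> set q = {}) P"
    using assms(1) unfolding inf_disjoint_paths_def by blast
  have "finite ?Y" using assms by simp
  then obtain p where p: "p \<in> P" "set p \<inter> ?Y = {}"
    by (rule infinite_disjoint_family_avoid[OF P(1,3), THEN bexE])
  then have path: "vwalk p (with_proj D)" "set p \<inter> pverts N1 = {hd p}" "set p \<inter> pverts N2 = {last p}"
    using P(2)[OF p(1)] by (auto simp only: set_path_def vpath_def)
  then have "set p \<subseteq> V - X" using p by (auto simp: vwalk_def)
  then have "(hd p, last p) \<in> rtrancl_on (V - X) E"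
    using vwalk_imp_rtrancl_on path by blast
  moreover have "hd p \<in> strong_class E (V - X) v" using p path by blast
  moreover have "last p \<in> strong_class E (V - X) w" using p path by blast
  ultimately show ?thesis
    unfolding strong_class_def by (metis (mono_tags, lifting) mem_Collect_eq rtrancl_on_trans)
qed

lemma inf_disjoint_pathsI:
  assumes N: "N1 \<in> necklaces_in D" "N2 \<in> necklaces_in D"
    and same: "\<And>X. finite X \<Longrightarrow> \<exists>v. finite (pverts N1 - strong_class E (V - X) v) \<and>
      finite (pverts N2 - strong_class E (V - X) v)"
  shows "inf_disjoint_paths D N1 N2"
  unfolding inf_disjoint_paths_def
proof (rule infinite_disjoint_familyI)
  fix X :: "'a set" assume "finite X"
  then obtain v where v: "finite (pverts N1 - strong_class E (V - X) v)"
    "finite (pverts N2 - strong_class E (V - X) v)" using same by blast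
  obtain a b where "a \<in> strong_class E (V - X) v" "a \<in> pverts N1" "b \<in> strong_class E (V - X) v" "b \<in> pverts N2"
    using necklace_meets[OF N(1) v(1) v(1)] necklace_meets[OF N(2) v(2) v(2)] by auto
  then have "(a, b) \<in> rtrancl_on (V - X) E" "a \<in> pverts N1" "b \<in> pverts N2"
    by (auto simp: strong_class_def intro: rtrancl_on_trans)
  then obtain p where "set_path D (pverts N1) (pverts N2) p" "set p \<subseteq> V - X"
    by (meson Diff_subset ex_set_path)
  then show "\<exists>p. set_path D (pverts N1) (pverts N2) p \<and> set p \<inter> X = {}" by blast
qed (auto simp: set_path_def vpath_def vwalk_def)

text \<open>Equivalence means that no finite set sends the two necklaces into different components.
  Disjoint paths disappear from here on, and transitivity reduces to the fact that two components
  containing almost all of one necklace coincide.\<close>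

lemma necklace_rel_iff:
  "(N1, N2) \<in> necklace_rel D \<longleftrightarrow> N1 \<in> necklaces_in D \<and> N2 \<in> necklaces_in D \<and>
    (\<forall>X. finite X \<longrightarrow> (\<exists>v. finite (pverts N1 - strong_class E (V - X) v) \<and>
      finite (pverts N2 - strong_class E (V - X) v)))" (is "?L \<longleftrightarrow> ?R")
proof
  assume ?L
  then have N: "N1 \<in> necklaces_in D" "N2 \<in> necklaces_in D"
    and paths: "inf_disjoint_paths D N1 N2" "inf_disjoint_paths D N2 N1"
    by (auto simp: necklace_rel_def)
  have "\<exists>v. finite (pverts N1 - strong_class E (V - X) v) \<and> finite (pverts N2 - strong_class E (V - X) v)"
    if X: "finite X" for X
  proof -
    obtain v w where v: "finite (pverts N1 - strong_class E (V - X) v)"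
      and w: "finite (pverts N2 - strong_class E (V - X) w)"
      using necklace_class[OF N(1) X] necklace_class[OF N(2) X] by blast
    have "w \<in> strong_class E (V - X) v"
      using inf_disjoint_paths_reach[OF paths(1) X v w] inf_disjoint_paths_reach[OF paths(2) X w v]
      by (simp add: strong_class_def)
    then show ?thesis using v w strong_class_eq by metis
  qed
  then show ?R using N by blast
next
  assume ?R
  then show ?L
    unfolding necklace_rel_def using inf_disjoint_pathsI[of N1 N2] inf_disjoint_pathsI[of N2 N1] by blast
qed

lemma equiv_necklace_rel: "equiv (necklaces_in D) (necklace_rel D)"
proof (rule equivI)
  show "necklace_rel D \<subseteq> necklaces_in D \<times> necklaces_in D" by (auto simp: necklace_rel_def)
  show "refl_on (necklaces_in D) (necklace_rel D)"
    using necklace_class by (auto intro!: refl_onI simp: necklace_rel_iff) blast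
  show "sym (necklace_rel D)" by (auto simp: sym_def necklace_rel_def)
  show "trans (necklace_rel D)"
  proof (rule transI)
    fix N1 N2 N3 assume 12: "(N1, N2) \<in> necklace_rel D" and 23: "(N2, N3) \<in> necklace_rel D"
    have N: "N1 \<in> necklaces_in D" "N2 \<in> necklaces_in D" "N3 \<in> necklaces_in D"
      using 12 23 by (auto simp: necklace_rel_iff)
    have "\<exists>v. finite (pverts N1 - strong_class E (V - X) v) \<and> finite (pverts N3 - strong_class E (V - X) v)"
      if X: "finite X" for X
    proof -
      obtain v w where v: "finite (pverts N1 - strong_class E (V - X) v)" "finite (pverts N2 - strong_class E (V - X) v)"
        and w: "finite (pverts N2 - strong_class E (V - X) w)" "finite (pverts N3 - strong_class E (V - X) w)"
        using 12 23 X unfolding necklace_rel_iff by meson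
      obtain x where "x \<in> strong_class E (V - X) v" "x \<in> strong_class E (V - X) w"
        using necklace_meets[OF N(2) v(2) w(1)] by blast
      then have "strong_class E (V - X) v = strong_class E (V - X) w"
        using strong_class_eq by metis
      then show ?thesis using v w by metis
    qed
    then show "(N1, N3) \<in> necklace_rel D" using N by (simp add: necklace_rel_iff)
  qed
qed

lemma end_nonempty:
  assumes "\<omega> \<in> ends D"
  obtains N where "N \<in> \<omega>" "N \<in> necklaces_in D" "\<omega> = necklace_rel D `` {N}"
  using assms equiv_class_self[OF equiv_necklace_rel] unfolding ends_def
  by (metis quotientE)

lemma eventually_in_meets:
  assumes "\<omega> \<in> ends D" "eventually_in \<omega> S" "eventually_in \<omega> S'"
  shows "S \<inter> S' \<noteq> {}"
  using assms end_nonempty necklace_meets unfolding eventually_in_def by (metis inf_bot_left)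

lemma eventually_in_mono: "eventually_in \<omega> S \<Longrightarrow> S \<subseteq> S' \<Longrightarrow> eventually_in \<omega> S'"
  unfolding eventually_in_def by (meson Diff_mono finite_subset subset_refl)

text \<open>Resolves the definite description in \<open>end_comp\<close>: components that contain
  almost all of the same infinite necklace share a vertex, hence agree.\<close>

lemma end_comp_eq:
  assumes "\<omega> \<in> ends D" "finite X"
  shows "\<exists>v \<in> V - X. end_comp D X \<omega> = with_proj (induced D (strong_class E (V - X) v)) \<and>
    eventually_in \<omega> (strong_class E (V - X) v)"
proof -
  obtain N where N: "N \<in> \<omega>" "N \<in> necklaces_in D" "\<omega> = necklace_rel D `` {N}"
    using end_nonempty[OF assms(1)] by metis
  obtain v where v: "v \<in> V - X" "finite (pverts N - strong_class E (V - X) v)"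
    using necklace_class[OF N(2) assms(2)] by blast
  let ?K = "strong_class E (V - X) v"
  have uniq: "strong_class E (V - X) w = ?K" if "finite (pverts N - strong_class E (V - X) w)" for w
    using necklace_meets[OF N(2) v(2) that] strong_class_eq by (metis IntE ex_in_conv)
  have ev: "eventually_in \<omega> ?K"
    unfolding eventually_in_def
  proof
    fix N' assume "N' \<in> \<omega>"
    then have "(N, N') \<in> necklace_rel D" using N(3) by blast
    then obtain w where "finite (pverts N - strong_class E (V - X) w)" "finite (pverts N' - strong_class E (V - X) w)"
      using assms(2) unfolding necklace_rel_iff by meson
    then show "finite (pverts N' - ?K)" using uniq by metis
  qed
  have "end_comp D X \<omega> = with_proj (induced D ?K)"
    unfolding end_comp_def sccs_restrict
  proof (rule the_equality, safe)
    show "with_proj (induced D ?K) \<in> (\<lambda>v. with_proj (induced D (strong_class E (V - X) v))) ` (V - X)"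
      using v by blast
    show "finite (pverts N - verts (with_proj (induced D ?K)))" if "N \<in> \<omega>" for N
      using ev that by (auto simp: eventually_in_def)
    fix w assume "\<forall>N\<in>\<omega>. finite (pverts N - verts (with_proj (induced D (strong_class E (V - X) w))))"
    then have "finite (pverts N - strong_class E (V - X) w)" using N(1) by auto
    then show "with_proj (induced D (strong_class E (V - X) w)) = with_proj (induced D ?K)"
      using uniq by simp
  qed
  then show ?thesis using v ev by blast
qed

lemma end_verts_class:
  assumes "\<omega> \<in> ends D" "finite X"
  shows "\<exists>v \<in> V - X. end_verts D X \<omega> = strong_class E (V - X) v"
  using end_comp_eq[OF assms] by auto

lemma eventually_in_end_verts:
  assumes "\<omega> \<in> ends D" "finite X"
  shows "eventually_in \<omega> (end_verts D X \<omega>)"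
  using end_comp_eq[OF assms] by auto

lemma end_comp_eq_iff:
  assumes "\<omega> \<in> ends D" "\<eta> \<in> ends D" "finite X"
  shows "end_comp D X \<omega> = end_comp D X \<eta> \<longleftrightarrow> end_verts D X \<omega> = end_verts D X \<eta>"
  using end_comp_eq[OF assms(1,3)] end_comp_eq[OF assms(2,3)] by auto

lemma end_verts_subset: "\<lbrakk>\<omega> \<in> ends D; finite X\<rbrakk> \<Longrightarrow> end_verts D X \<omega> \<subseteq> V - X"
  using end_verts_class strong_class_subset by metis

lemma eventually_in_subset_end_verts:
  assumes "\<omega> \<in> ends D" "finite X" "strong_set E S" "S \<subseteq> V - X" "eventually_in \<omega> S"
  shows "S \<subseteq> end_verts D X \<omega>"
proof -
  obtain x where x: "x \<in> S" "x \<in> end_verts D X \<omega>"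
    using eventually_in_meets[OF assms(1,5) eventually_in_end_verts[OF assms(1,2)]] by blast
  then show ?thesis
    using strong_set_subset_class'[OF assms(3,4)] end_verts_class[OF assms(1,2)] by metis
qed

lemma strong_end_verts:
  assumes "\<omega> \<in> ends D" "finite X"
  shows "strong_set E (end_verts D X \<omega>)"
  using end_verts_class[OF assms] strong_set_strong_class by metis

lemma end_verts_eq_class_iff:
  assumes "\<omega> \<in> ends D" "finite X"
  shows "end_verts D X \<omega> = strong_class E (V - X) v \<longleftrightarrow> eventually_in \<omega> (strong_class E (V - X) v)"
proof
  assume ev: "eventually_in \<omega> (strong_class E (V - X) v)"
  obtain w where w: "end_verts D X \<omega> = strong_class E (V - X) w" using end_verts_class[OF assms] by blast
  obtain x where "x \<in> strong_class E (V - X) v" "x \<in> end_verts D X \<omega>"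
    using eventually_in_meets[OF assms(1) ev eventually_in_end_verts[OF assms]] by blast
  then show "end_verts D X \<omega> = strong_class E (V - X) v" using w strong_class_eq by metis
qed (use eventually_in_end_verts[OF assms] in simp)

lemma end_verts_antimono:
  assumes "\<omega> \<in> ends D" "finite Y" "X \<subseteq> Y"
  shows "end_verts D Y \<omega> \<subseteq> end_verts D X \<omega>"
proof (rule eventually_in_subset_end_verts)
  show "end_verts D Y \<omega> \<subseteq> V - X" using end_verts_subset[OF assms(1,2)] assms(3) by blast
qed (use assms eventually_in_end_verts strong_end_verts in \<open>auto intro: finite_subset\<close>)

text \<open>Inequivalent necklaces are split by some \<open>X\<close> according to
  \<open>necklace_rel_iff\<close>, and different components of the same remainder are
  disjoint.\<close>

lemma ends_separated:
  assumes "\<omega> \<in> ends D" "\<eta> \<in> ends D" "\<omega> \<noteq> \<eta>"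
  obtains X where "finite X" "end_verts D X \<omega> \<inter> end_verts D X \<eta> = {}"
proof -
  obtain N where N: "N \<in> \<omega>" "N \<in> necklaces_in D" "\<omega> = necklace_rel D `` {N}"
    using end_nonempty[OF assms(1)] by metis
  obtain M where M: "M \<in> \<eta>" "M \<in> necklaces_in D" "\<eta> = necklace_rel D `` {M}"
    using end_nonempty[OF assms(2)] by metis
  have "(N, M) \<notin> necklace_rel D"
    using assms(3) N M equiv_class_eq[OF equiv_necklace_rel] by metis
  then obtain X where X: "finite X" and no: "\<And>v. \<not> (finite (pverts N - strong_class E (V - X) v) \<and>
      finite (pverts M - strong_class E (V - X) v))"
    unfolding necklace_rel_iff using N M by blast
  obtain v where v: "end_verts D X \<omega> = strong_class E (V - X) v" using end_verts_class[OF assms(1) X] by blast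
  obtain w where w: "end_verts D X \<eta> = strong_class E (V - X) w" using end_verts_class[OF assms(2) X] by blast
  have "finite (pverts N - strong_class E (V - X) v)" "finite (pverts M - strong_class E (V - X) w)"
    using eventually_in_end_verts[OF assms(1) X] eventually_in_end_verts[OF assms(2) X] N M v w
    by (auto simp: eventually_in_def)
  then have "strong_class E (V - X) v \<noteq> strong_class E (V - X) w" using no by metis
  then have "end_verts D X \<omega> \<inter> end_verts D X \<eta> = {}"
    unfolding v w by (metis disjoint_iff strong_class_eq)
  then show ?thesis using that X by blast
qed

lemma end_of_necklace:
  assumes "N \<in> necklaces_in D"
  shows "necklace_rel D `` {N} \<in> ends D" "N \<in> necklace_rel D `` {N}"
  using assms equiv_class_self[OF equiv_necklace_rel] by (auto simp: ends_def quotientI)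

end

section \<open>Centered ranks\<close>

text \<open>Equivalently, every strongly connected subgraph has exactly one vertex of least rank.\<close>

definition centered :: "'a pair_pre_digraph \<Rightarrow> ('a \<Rightarrow> nat) \<Rightarrow> bool" where
  "centered D \<rho> \<longleftrightarrow> (\<forall>u \<in> pverts D. \<forall>v \<in> strong_class (parcs D) {w \<in> pverts D. \<rho> u \<le> \<rho> w} u. \<rho> u = \<rho> v \<longrightarrow> u = v)"

text \<open>Topologically: no end lies in the closure of the vertices in \<open>U\<close>.\<close>

definition dispersed :: "'a pair_pre_digraph \<Rightarrow> 'a set \<Rightarrow> bool" where
  "dispersed D U \<longleftrightarrow> (\<forall>\<omega> \<in> ends D. \<exists>X. finite X \<and> end_verts D X \<omega> \<inter> U = {})"

section \<open>From a metric to a cover by dispersed sets\<close>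

context wf_pair_digraph
begin

text \<open>Among the generators only the sets \<open>C_hat\<close> contain ends. One that is
  centred at another end but contains \<open>\<omega>\<close> has the same component for both
  ends.\<close>

lemma open_end_neighbourhood:
  assumes "openin (DTop D) W" "\<omega> \<in> ends D" "Node (End \<omega>) \<in> W"
  shows "\<exists>X. finite X \<and> (\<forall>v \<in> end_verts D X \<omega>. Node (Vert v) \<in> W)"
proof -
  have "generate_topology_on (basic_opens D) W"
    using assms(1) unfolding DTop_def openin_topology_generated_by_iff .
  then show ?thesis using assms(3)
  proof (induction rule: generate_topology_on.induct)
    case (Int a b)
    then obtain X Y where XY: "finite X" "\<forall>v \<in> end_verts D X \<omega>. Node (Vert v) \<in> a"
      "finite Y" "\<forall>v \<in> end_verts D Y \<omega>. Node (Vert v) \<in> b" by blast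
    then show ?case
      using end_verts_antimono[OF assms(2), of "X \<union> Y" X] end_verts_antimono[OF assms(2), of "X \<union> Y" Y]
      by (intro exI[of _ "X \<union> Y"]) auto
  next
    case (UN K)
    then obtain k where k: "k \<in> K" "Node (End \<omega>) \<in> k" by blast
    then obtain X where "finite X" "\<forall>v \<in> end_verts D X \<omega>. Node (Vert v) \<in> k" using UN.IH by meson
    then show ?case using k(1) by (intro exI[of _ X]) blast
  next
    case (Basis s)
    then consider \<epsilon> X \<eta> where "s = C_hat D \<epsilon> X \<eta>" "finite X"
      | "\<exists>v \<epsilon>. s = uniform_star D v \<epsilon>" | "\<exists>u v a b. s = edge_interval u v a b"
      | "\<exists>\<epsilon> X x y t. s = E_hat D \<epsilon> X x y t"
      unfolding basic_opens_def by blast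
    then show ?case
    proof cases
      case 1
      then have "end_comp D X \<omega> = end_comp D X \<eta>"
        using Basis by (auto simp: C_hat_def comp_nodes_def)
      then show ?thesis using 1 by (intro exI[of _ X]) (auto simp: C_hat_def comp_nodes_def)
    qed (use Basis in \<open>auto simp: uniform_star_def edge_interval_def E_hat_def\<close>)
  qed auto
qed

lemma openin_uniform_star: "v \<in> V \<Longrightarrow> 0 < \<epsilon> \<Longrightarrow> openin (DTop D) (uniform_star D v \<epsilon>)"
  unfolding DTop_def by (rule topology_generated_by_Basis) (auto simp: basic_opens_def)

lemma openin_C_hat:
  "\<omega> \<in> ends D \<Longrightarrow> finite X \<Longrightarrow> X \<subseteq> V \<Longrightarrow> 0 < \<epsilon> \<Longrightarrow> openin (DTop D) (C_hat D \<epsilon> X \<omega>)"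
  unfolding DTop_def by (rule topology_generated_by_Basis) (unfold basic_opens_def, blast)

lemma end_in_topspace:
  assumes "\<omega> \<in> ends D"
  shows "Node (End \<omega>) \<in> topspace (DTop D)"
proof -
  have "Node (End \<omega>) \<in> C_hat D 1 {} \<omega>" using assms by (auto simp: C_hat_def comp_nodes_def)
  then show ?thesis using openin_subset[OF openin_C_hat[OF assms, of "{}" 1]] by auto
qed

lemma metrizable_imp_dispersed_cover:
  assumes "metrizable_space (DTop D)"
  shows "\<exists>U :: nat \<Rightarrow> 'a set. V \<subseteq> (\<Union>n. U n) \<and> (\<forall>n. dispersed D (U n))"
proof -
  obtain M d where "Metric_space M d" and top: "DTop D = Metric_space.mtopology M d"
    using assms unfolding metrizable_space_def by blast
  then interpret Metric_space M d by simp
  define U where "U = (\<lambda>n::nat. {v. \<forall>\<omega> \<in> ends D. d (Node (End \<omega>)) (Node (Vert v)) \<ge> inverse (Suc n)})"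
  have "\<exists>n. v \<in> U n" if "v \<in> V" for v
  proof -
    \<comment> \<open>A star contains no end, so \<open>v\<close> has positive distance from the set
      of all ends.\<close>
    have "openin mtopology (uniform_star D v 1)" using openin_uniform_star[OF that] top by simp
    then obtain r where r: "r > 0" "mball (Node (Vert v)) r \<subseteq> uniform_star D v 1" and v: "Node (Vert v) \<in> M"
      unfolding openin_mtopology by (auto simp: uniform_star_def)
    obtain n where n: "inverse (Suc n) < r" using reals_Archimedean[OF r(1)] by blast
    have "d (Node (End \<omega>)) (Node (Vert v)) \<ge> inverse (Suc n)" if w: "\<omega> \<in> ends D" for \<omega>
    proof (rule ccontr)
      assume "\<not> ?thesis"
      then have "d (Node (Vert v)) (Node (End \<omega>)) < r" using n by (simp add: commute)
      moreover have "Node (End \<omega>) \<in> M" using end_in_topspace[OF w] by (simp add: top)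
      ultimately have "Node (End \<omega>) \<in> uniform_star D v 1" using r(2) v by (auto simp: in_mball)
      then show False by (auto simp: uniform_star_def)
    qed
    then show ?thesis by (auto simp: U_def)
  qed
  moreover have "dispersed D (U n)" for n
    unfolding dispersed_def
  proof
    fix \<omega> assume w: "\<omega> \<in> ends D"
    show "\<exists>X. finite X \<and> end_verts D X \<omega> \<inter> U n = {}"
    proof -
      have "Node (End \<omega>) \<in> M" using end_in_topspace[OF w] by (simp add: top)
      \<comment> \<open>The ball has exactly the radius that \<open>U n\<close> forbids, so none of
        these vertices is in \<open>U n\<close>.\<close>
      then have "\<exists>X. finite X \<and> (\<forall>v \<in> end_verts D X \<omega>. Node (Vert v) \<in> mball (Node (End \<omega>)) (inverse (Suc n)))"
        by (intro open_end_neighbourhood w) (auto simp: top)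
      then show ?thesis using w by (fastforce simp: U_def)
    qed
  qed
  ultimately show ?thesis by blast
qed

end

text \<open>
  A vertex \<open>v\<close> passes through stages \<open>(C, K)\<close>: \<open>K\<close> is a finite set that is deleted from the strong
  set \<open>C\<close>, and the next \<open>C\<close> is the class of what remains around \<open>v\<close>. Consecutive sets \<open>K\<close> share a
  target vertex of least possible level, so a vertex that is never deleted produces a necklace
  with infinitely many vertices in one dispersed set.
\<close>

locale dispersed_cover = wf_pair_digraph +
  fixes U :: "nat \<Rightarrow> 'a set"
  assumes strong_D: "strong_set E V"
    and cover: "V \<subseteq> (\<Union>n. U n)"
    and dispersed_U: "dispersed D (U n)"
begin

definition level :: "'a set \<Rightarrow> nat" where
  "level C = (LEAST m. U m \<inter> C \<noteq> {})"

definition target :: "'a set \<Rightarrow> 'a" where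
  "target C = (SOME u. u \<in> U (level C) \<inter> C)"

definition connector :: "'a set \<Rightarrow> 'a \<Rightarrow> 'a \<Rightarrow> 'a set" where
  "connector C u v = (SOME K. finite K \<and> K \<subseteq> C \<and> strong_set E K \<and> u \<in> K \<and> v \<in> K)"

text \<open>The values of \<open>target\<close> and \<open>connector\<close> depend on the regions
  only, not on \<open>v\<close>, so vertices that are not yet separated share all choices. The new
  removed set is chosen in the old region \<open>C\<close> because it must contain
  \<open>target C\<close>, which is already deleted: this is the link between consecutive removed
  sets.\<close>

primrec stage :: "nat \<Rightarrow> 'a \<Rightarrow> 'a set \<times> 'a set" where
  "stage 0 v = (V, {target V})"
| "stage (Suc n) v = (let C = fst (stage n v); C' = strong_class E (C - snd (stage n v)) v
    in (C', connector C (target C) (target C')))"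

abbreviation "region n v \<equiv> fst (stage n v)"
abbreviation "removed n v \<equiv> snd (stage n v)"

text \<open>The guard under which the stage is meaningful: the class of a deleted vertex is empty,
  and later targets are arbitrary.\<close>

definition alive :: "nat \<Rightarrow> 'a \<Rightarrow> bool" where
  "alive n v \<longleftrightarrow> v \<in> V \<and> (\<forall>j<n. v \<notin> removed j v)"

lemma alive_mono: "alive n v \<Longrightarrow> m \<le> n \<Longrightarrow> alive m v"
  by (auto simp: alive_def)

lemma level_target:
  assumes "strong_set E C" "C \<subseteq> V"
  shows "target C \<in> C" "target C \<in> U (level C)"
proof -
  obtain x where "x \<in> C" using assms by (auto simp: strong_set_def)
  then have "\<exists>m. U m \<inter> C \<noteq> {}" using cover assms by blast
  then have "U (level C) \<inter> C \<noteq> {}" unfolding level_def by (rule LeastI_ex)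
  then have "target C \<in> U (level C) \<inter> C" unfolding target_def by (rule some_in_eq[THEN iffD2])
  then show "target C \<in> C" "target C \<in> U (level C)" by auto
qed

lemma level_mono:
  assumes "strong_set E C" "C \<subseteq> V" "C \<subseteq> C'"
  shows "level C' \<le> level C"
  using level_target[OF assms(1,2)] assms(3) unfolding level_def[of C'] by (intro Least_le) blast

lemma connector:
  assumes "strong_set E C" "u \<in> C" "v \<in> C"
  shows "finite (connector C u v)" "connector C u v \<subseteq> C" "strong_set E (connector C u v)"
    "u \<in> connector C u v" "v \<in> connector C u v"
  using someI_ex[OF strong_set_finite_pair[OF assms]] unfolding connector_def by auto

lemma region_alive:
  assumes "alive n v"
  shows "v \<in> region n v \<and> region n v \<subseteq> V \<and> strong_set E (region n v)"
  using assms
proof (induction n)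
  case 0
  then show ?case using strong_D by (auto simp: alive_def)
next
  case (Suc n)
  then have IH: "v \<in> region n v" "region n v \<subseteq> V" and v: "v \<notin> removed n v"
    by (auto simp: alive_def)
  then have "v \<in> region n v - removed n v" by blast
  moreover have "region (Suc n) v = strong_class E (region n v - removed n v) v"
    by (simp add: Let_def)
  ultimately show ?case
    using IH(2) strong_class_self strong_set_strong_class strong_class_subset by (metis Diff_subset subset_trans)
qed

lemma region_Suc_subset: "region (Suc n) v \<subseteq> region n v - removed n v"
  by (simp add: Let_def strong_class_subset)

lemma region_antimono: "m \<le> n \<Longrightarrow> region n v \<subseteq> region m v"
  by (rule lift_Suc_antimono_le[of "\<lambda>n. region n v"]) (use region_Suc_subset in blast)+

lemma removed_Suc:
  assumes "alive (Suc n) v"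
  shows "finite (removed (Suc n) v)" "removed (Suc n) v \<subseteq> region n v"
    "strong_set E (removed (Suc n) v)" "target (region n v) \<in> removed (Suc n) v"
    "target (region (Suc n) v) \<in> removed (Suc n) v"
proof -
  let ?C = "region n v" and ?C' = "region (Suc n) v"
  have C: "strong_set E ?C" "?C \<subseteq> V" using region_alive alive_mono[OF assms] by auto
  have C': "strong_set E ?C'" "?C' \<subseteq> V" using region_alive[OF assms] by auto
  have t: "target ?C \<in> ?C" "target ?C' \<in> ?C"
    using level_target[OF C] level_target[OF C'] region_Suc_subset by auto
  have "removed (Suc n) v = connector ?C (target ?C) (target ?C')" by (simp add: Let_def)
  with connector[OF C(1) t]
  show "finite (removed (Suc n) v)" "removed (Suc n) v \<subseteq> ?C"
    "strong_set E (removed (Suc n) v)" "target ?C \<in> removed (Suc n) v"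
    "target ?C' \<in> removed (Suc n) v" by metis+
qed

lemma removed_alive:
  assumes "alive n v"
  shows "finite (removed n v)" "removed n v \<subseteq> V" "strong_set E (removed n v)"
    "target (region n v) \<in> removed n v"
proof -
  have "finite (removed n v) \<and> removed n v \<subseteq> V \<and> strong_set E (removed n v) \<and> target (region n v) \<in> removed n v"
  proof (cases n)
    case 0
    then show ?thesis using level_target[OF strong_D] by (auto simp: strong_set_singleton)
  next
    case (Suc k)
    then show ?thesis
      using removed_Suc[of k v] region_alive[of k v] alive_mono[of n v k] assms by auto
  qed
  then show "finite (removed n v)" "removed n v \<subseteq> V" "strong_set E (removed n v)"
    "target (region n v) \<in> removed n v" by auto
qed

text \<open>A strong set that has lost no vertex lies inside one class, so its vertices continue
  with the same region and the same removed set.\<close>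

lemma stage_eq:
  assumes "strong_set E S" "S \<subseteq> V" "\<And>w. w \<in> S \<Longrightarrow> alive n w" "u \<in> S" "v \<in> S"
  shows "stage n u = stage n v"
proof -
  have "(\<forall>w \<in> S. stage n w = stage n u) \<and> S \<subseteq> region n u"
    using assms(3)
  proof (induction n)
    case 0
    then show ?case using assms by simp
  next
    case (Suc n)
    then have IH: "\<And>w. w \<in> S \<Longrightarrow> stage n w = stage n u" "S \<subseteq> region n u"
      using alive_mono by (meson le_Suc_eq order_refl)+
    have "w \<notin> removed n u" if "w \<in> S" for w
      using Suc.prems[OF that] IH(1)[OF that] by (auto simp: alive_def)
    then have "S \<subseteq> region n u - removed n u" using IH(2) by blast
    then have cl: "S \<subseteq> strong_class E (region n u - removed n u) w" if "w \<in> S" for w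
      using strong_set_subset_class[OF assms(1)] that by blast
    have "strong_class E (region n u - removed n u) w = strong_class E (region n u - removed n u) u"
      if "w \<in> S" for w
      using that by (intro strong_class_eq set_mp[OF cl[OF assms(4)]])
    then show ?case using IH(1) cl[OF assms(4)] by (simp add: Let_def)
  qed
  then show ?thesis using assms(4,5) by metis
qed

lemma not_always_alive:
  assumes "v \<in> V"
  shows "\<exists>n. v \<in> removed n v"
proof (rule ccontr)
  assume "\<not> ?thesis"
  then have alive: "alive n v" for n using assms by (auto simp: alive_def)
  let ?C = "\<lambda>n. region n v" and ?K = "\<lambda>n. removed n v" and ?t = "\<lambda>n. target (region n v)"
  have disj: "?K i \<inter> ?C j = {}" if "i < j" for i j
    using region_Suc_subset[of i v] region_antimono[of "Suc i" j v] that by auto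
  \<comment> \<open>\<open>?K j\<close> lies in region \<open>j - 1\<close>, which has lost
    \<open>?K i\<close> only if \<open>i < j - 1\<close>. Hence consecutive sets may meet, as the
    beads of a necklace must.\<close>
  have "?K i \<inter> ?K j = {}" if "i + 2 \<le> j" for i j
    using disj[of i "j - 1"] removed_Suc(2)[OF alive, of "j - 1"] that by (cases j) auto
  moreover have "?K n \<inter> ?K (Suc n) \<noteq> {}" for n
    using IntI[OF removed_alive(4)[OF alive, of n] removed_Suc(4)[OF alive, of n]]
    by (simp only: ex_in_conv[symmetric]) (rule exI)
  ultimately have "\<exists>N \<in> necklaces_in D. pverts N = (\<Union>n. ?K n)"
    using removed_alive[OF alive] by (intro necklace_of_chain[OF wf_D])
  then obtain N where N: "N \<in> necklaces_in D" "pverts N = (\<Union>n. ?K n)" by blast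
  have C: "strong_set E (?C n)" "?C n \<subseteq> V" "v \<in> ?C n" for n using region_alive[OF alive] by auto
  obtain m where m: "v \<in> U m" using cover assms by blast
  \<comment> \<open>Since \<open>v\<close> stays in every region, the levels are bounded by the
    index of a dispersed set containing \<open>v\<close>. They never decrease, so they are constant
    from the stage \<open>k\<close> of the maximum on.\<close>
  have lev_le: "level (?C n) \<le> m" for n
    using C(3)[of n] m unfolding level_def by (intro Least_le) blast
  then have fin: "finite (range (\<lambda>n. level (?C n)))"
    by (intro finite_subset[OF _ finite_atMost[of m]]) auto
  then have "Max (range (\<lambda>n. level (?C n))) \<in> range (\<lambda>n. level (?C n))" by (intro Max_in) auto
  then obtain k where k: "Max (range (\<lambda>n. level (?C n))) = level (?C k)" by (rule rangeE)
  have lev: "level (?C n) = level (?C k)" if "k \<le> n" for n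
  proof (rule antisym)
    show "level (?C n) \<le> level (?C k)" using fin k by (metis Max_ge rangeI)
    show "level (?C k) \<le> level (?C n)" using level_mono C region_antimono[OF that] by auto
  qed
  \<comment> \<open>A target is deleted at its own stage and missing from all later regions. The
    necklace thus has infinitely many vertices in one dispersed set.\<close>
  have "inj (\<lambda>n. ?t (k + n))"
  proof (rule linorder_inj_onI)
    fix i j :: nat assume "i < j"
    then show "?t (k + i) \<noteq> ?t (k + j)"
      using disj[of "k + i" "k + j"] removed_alive(4)[OF alive, of "k + i"] level_target(1)[OF C(1,2), of "k + j"]
      by auto
  qed auto
  then have inf: "infinite (range (\<lambda>n. ?t (k + n)))" by (rule range_inj_infinite)
  have tU: "?t (k + n) \<in> U (level (?C k))" for n
    using level_target(2)[OF C(1,2), of "k + n"] lev[of "k + n"] by simp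
  define \<omega> where "\<omega> = necklace_rel D `` {N}"
  have w: "\<omega> \<in> ends D" "N \<in> \<omega>" using end_of_necklace[OF N(1)] by (auto simp: \<omega>_def)
  then obtain X where X: "finite X" "end_verts D X \<omega> \<inter> U (level (?C k)) = {}"
    using dispersed_U unfolding dispersed_def by blast
  have "finite (pverts N - end_verts D X \<omega>)"
    using eventually_in_end_verts[OF w(1) X(1)] w(2) by (simp add: eventually_in_def)
  moreover have "range (\<lambda>n. ?t (k + n)) \<subseteq> pverts N - end_verts D X \<omega>"
    using tU X(2) N(2) removed_alive(4)[OF alive] by blast
  ultimately show False using inf finite_subset by blast
qed

lemma centered_exists: "\<exists>\<rho>. centered D \<rho>"
proof -
  define \<sigma> where "\<sigma> = (\<lambda>v. LEAST n. v \<in> removed n v)"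
  have \<sigma>: "v \<in> removed (\<sigma> v) v" "alive (\<sigma> v) v" if "v \<in> V" for v
    using LeastI_ex[OF not_always_alive[OF that]] not_less_Least that
    by (auto simp: \<sigma>_def alive_def)
  \<comment> \<open>The number of vertices deleted at earlier stages, plus the position of
    \<open>v\<close> in the finite set with which it is deleted. Within a strong set this orders
    first by stage, then by position.\<close>
  define \<rho> where "\<rho> = (\<lambda>v. (\<Sum>j<\<sigma> v. card (removed j v)) + to_nat_on (removed (\<sigma> v) v) v)"
  have "u = v" if u: "u \<in> V" and v: "v \<in> strong_class E {w \<in> V. \<rho> u \<le> \<rho> w} u" and eq: "\<rho> u = \<rho> v" for u v
  proof -
    let ?S = "strong_class E {w \<in> V. \<rho> u \<le> \<rho> w} u"
    have S: "strong_set E ?S" "?S \<subseteq> V" "u \<in> ?S" "\<And>w. w \<in> ?S \<Longrightarrow> \<rho> u \<le> \<rho> w"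
      using u strong_class_subset[of E "{w \<in> V. \<rho> u \<le> \<rho> w}" u]
      by (auto intro: strong_set_strong_class strong_class_self)
    \<comment> \<open>Up to the stage at which the first vertex \<open>w\<close> is deleted, that
      stage included, all vertices of \<open>?S\<close> share their regions and removed
      sets.\<close>
    obtain w where w: "w \<in> ?S" "\<And>x. x \<in> ?S \<Longrightarrow> \<sigma> w \<le> \<sigma> x"
      using ex_has_least_nat[of "\<lambda>x. x \<in> ?S" u \<sigma>] S(3) by blast
    have st: "stage j x = stage j w" if "x \<in> ?S" "j \<le> \<sigma> w" for x j
    proof (rule stage_eq[OF S(1,2)])
      fix y assume y: "y \<in> ?S"
      then have "y \<in> V" using S(2) by blast
      then show "alive j y" using \<sigma>(2)[of y] w(2)[OF y] that(2) alive_mono by (meson le_trans)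
    qed (use that w in auto)
    let ?K = "removed (\<sigma> w) w" and ?b = "\<Sum>j<\<sigma> w. card (removed j w)"
    have wV: "w \<in> V" using w S by blast
    have bij: "bij_betw (to_nat_on ?K) ?K {..<card ?K}"
      using removed_alive(1)[OF \<sigma>(2)[OF wV]] by (rule to_nat_on_finite)
    then have "to_nat_on ?K w < card ?K" using \<sigma>(1)[OF wV] by (auto simp: bij_betw_def)
    then have w_less: "\<rho> w < ?b + card ?K" by (simp add: \<rho>_def)
    \<comment> \<open>A vertex of \<open>?S\<close> deleted later counts all of \<open>?K\<close>
      and so has rank at least \<open>?b + card ?K\<close>, above \<open>\<rho> w\<close>. Therefore
      \<open>u\<close> and \<open>v\<close> both lie in \<open>?K\<close>, where positions are
      injective.\<close>
    have least: "\<sigma> x = \<sigma> w \<and> x \<in> ?K \<and> \<rho> x = ?b + to_nat_on ?K x" if x: "x \<in> ?S" "\<rho> x \<le> \<rho> w" for x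
    proof -
      have "\<not> \<sigma> w < \<sigma> x"
      proof
        assume less: "\<sigma> w < \<sigma> x"
        have "?b + card ?K = (\<Sum>j<Suc (\<sigma> w). card (removed j x))"
          using st[OF x(1)] by (simp add: le_less)
        also have "\<dots> \<le> (\<Sum>j<\<sigma> x. card (removed j x))"
          by (rule sum_mono2) (use less in auto)
        also have "\<dots> \<le> \<rho> x" by (simp add: \<rho>_def)
        finally show False using w_less x(2) by simp
      qed
      then have "\<sigma> x = \<sigma> w" using w(2)[OF x(1)] by simp
      moreover have "x \<in> V" using x S by blast
      ultimately show ?thesis
        using \<sigma>(1)[of x] st[OF x(1)] by (simp add: \<rho>_def)
    qed
    have "\<rho> u \<le> \<rho> w" using S(4)[OF w(1)] .
    then have "to_nat_on ?K u = to_nat_on ?K v" "u \<in> ?K" "v \<in> ?K"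
      using least[OF S(3)] least[OF v] eq by auto
    then show ?thesis using bij by (meson bij_betw_imp_inj_on inj_onD)
  qed
  then have "centered D \<rho>" unfolding centered_def by blast
  then show ?thesis by blast
qed

end

section \<open>Paths in rooted trees\<close>

lemma vwalk_iff_successively:
  "vwalk p (with_proj T) \<longleftrightarrow> p \<noteq> [] \<and> set p \<subseteq> pverts T \<and> successively (\<lambda>a b. (a, b) \<in> parcs T) p"
  unfolding vwalk_def by (induction p rule: vwalk_arcs.induct) auto

lemma vwalk_arcs_closed:
  assumes "c \<noteq> []"
  shows "pawalk_verts (hd c) (vwalk_arcs c) = c" "pcas (hd c) (vwalk_arcs c) (last c)"
  using assms by (induction c rule: vwalk_arcs.induct) auto

lemma pcas_nth:
  assumes "pcas u c v" "i < length c"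
  shows "c ! i = (pawalk_verts u c ! i, pawalk_verts u c ! Suc i)"
  using assms
proof (induction c arbitrary: u i)
  case (Cons e c)
  show ?case
  proof (cases i)
    case 0
    then show ?thesis using Cons.prems by (cases c) (auto simp: prod_eq_iff)
  next
    case (Suc j)
    then show ?thesis using Cons.IH[of "snd e" j] Cons.prems by auto
  qed
qed simp

text \<open>A closed walk repeats its first vertex, so four list entries mean three arcs, the length
  from which on \<open>rooted_tree\<close> excludes cycles.\<close>

lemma no_long_closed_vwalk:
  assumes "rooted_tree T r" "vwalk c (with_proj T)" "hd c = last c" "distinct (tl c)" "4 \<le> length c"
  shows False
proof -
  interpret pair_bidirected_digraph T using assms by (simp add: rooted_tree_def)
  have c: "c \<noteq> []" "hd c \<in> pverts T" "set (vwalk_arcs c) \<subseteq> parcs T" using assms by (auto simp: vwalk_def)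
  have "length (vwalk_arcs c) = length c - 1"
    by (rule vwalk_length_simp[unfolded vwalk_length_def])
  then have len: "3 \<le> length (vwalk_arcs c)" using assms(5) by simp
  have "awalk (hd c) (vwalk_arcs c) (hd c)"
    using vwalk_arcs_closed[OF c(1)] c assms(3) by (simp add: awalk_def)
  moreover have "distinct (tl (pawalk_verts (hd c) (vwalk_arcs c)))"
    using assms(4) vwalk_arcs_closed[OF c(1)] by simp
  ultimately have "cycle (vwalk_arcs c)"
    unfolding cycle_def using len by (intro exI[of _ "hd c"]) auto
  then show False using assms(1) len by (auto simp: rooted_tree_def)
qed

lemma rooted_tree_unique_vpath:
  assumes tree: "rooted_tree T r"
    and "vpath p (with_proj T)" "vpath q (with_proj T)" "hd p = hd q" "last p = last q"
  shows "p = q"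
  using assms(2-)
proof (induction p arbitrary: q)
  case Nil
  then show ?case by (auto simp: vpath_def vwalk_def)
next
  case (Cons x p)
  interpret pair_bidirected_digraph T using tree by (simp add: rooted_tree_def)
  obtain q' where q: "q = x # q'" using Cons.prems by (cases q) (auto simp: vpath_def vwalk_def)
  show ?case
  proof (cases "p = [] \<or> q' = []")
    case True
    then show ?thesis using Cons.prems q by (auto simp: vpath_def split: if_splits)
  next
    case False
    have vp: "vpath p (with_proj T)" "vpath q' (with_proj T)"
      using Cons.prems(1,2) False unfolding q
      by (auto simp: vpath_def vwalk_iff_successively successively_Cons)
    have l: "last p = last q'" using Cons.prems(4) False q by simp
    show ?thesis
    proof (cases "hd p = hd q'")
      case True
      then show ?thesis using Cons.IH[OF vp] l q by simp
    next
      case ne: False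
      have "last p \<in> set p" "last p \<in> set q'" using False l last_in_set by (metis, metis)
      \<comment> \<open>After the common start \<open>x\<close> the paths part at once;
        \<open>y\<close> is the first vertex of \<open>p\<close> at which they meet again.\<close>
      then obtain p1 y p2 where p: "p = p1 @ y # p2" "y \<in> set q'" "\<forall>z\<in>set p1. z \<notin> set q'"
        using split_list_first_prop[of p "\<lambda>z. z \<in> set q'"] by blast
      obtain q1 q2 where q': "q' = q1 @ y # q2" using p(2) by (meson split_list)
      \<comment> \<open>Out along one path to \<open>y\<close> and back along the other. As the
        heads differ, \<open>p1\<close> and \<open>q1\<close> are not both empty, which gives the
        length 4.\<close>
      let ?c = "x # p1 @ y # rev q1 @ [x]"
      have "successively (\<lambda>a b. (a, b) \<in> parcs T) (x # p1 @ [y])"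
        using Cons.prems(1) unfolding p vpath_def vwalk_iff_successively
        by (auto simp: successively_append_iff successively_Cons hd_append split: if_splits)
      moreover have "successively (\<lambda>a b. (a, b) \<in> parcs T) (x # q1 @ [y])"
        using Cons.prems(2) unfolding q q' vpath_def vwalk_iff_successively
        by (auto simp: successively_append_iff successively_Cons hd_append split: if_splits)
      then have "successively (\<lambda>a b. (a, b) \<in> parcs T) (rev (x # q1 @ [y]))"
        unfolding successively_rev by (rule successively_mono) (rule arcs_symmetric)
      then have "successively (\<lambda>a b. (a, b) \<in> parcs T) (y # rev q1 @ [x])"
        by (simp only: rev.simps rev_append append.simps append_assoc)
      ultimately have "successively (\<lambda>a b. (a, b) \<in> parcs T) ?c"
        by (auto simp: successively_append_iff successively_Cons hd_append split: if_splits)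
      then have "vwalk ?c (with_proj T)"
        using Cons.prems(1,2) unfolding q q' p vpath_def vwalk_iff_successively by auto
      moreover have "distinct (tl ?c)"
        using Cons.prems(1,2) p(3) unfolding q q' p(1) vpath_def by auto
      moreover have "4 \<le> length ?c"
        using ne unfolding p q' by (cases p1; cases q1) auto
      ultimately show ?thesis using no_long_closed_vwalk[OF tree, of ?c] by simp
    qed
  qed
qed

text \<open>Different vertices of equal height are incomparable. If both had least rank in a strong
  set, normality would put into the set a vertex strictly below both.\<close>

lemma normal_spanning_tree_imp_centered:
  assumes wf: "pair_wf_digraph D" and "has_normal_spanning_tree D"
  shows "\<exists>\<rho>. centered D \<rho>"
proof -
  obtain T r where "normal_tree D T r" and VT: "pverts T = pverts D"
    using assms by (auto simp: has_normal_spanning_tree_def)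
  then have W: "weak_normal_tree D T r" by (simp add: normal_tree_def)
  then have R: "rooted_tree T r" by (simp add: weak_normal_tree_def)
  interpret T: pair_bidirected_digraph T using R by (simp add: rooted_tree_def)
  have "\<exists>p. vpath p (with_proj T) \<and> hd p = r \<and> last p = v" if "v \<in> pverts T" for v
    using R that T.reachable_vpath_conv by (auto simp: rooted_tree_def strongly_connected_def)
  then obtain P where P: "\<And>v. v \<in> pverts T \<Longrightarrow> vpath (P v) (with_proj T) \<and> hd (P v) = r \<and> last (P v) = v"
    by metis
  \<comment> \<open>By uniqueness, the part of the root path of \<open>v\<close> up to
    \<open>u\<close> is the root path of \<open>u\<close>.\<close>
  have less: "length (P u) < length (P v)" if le: "tree_le T r u v" and "u \<noteq> v" "v \<in> pverts T" for u v
  proof -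
    obtain p where p: "vpath p (with_proj T)" "hd p = r" "last p = v" "u \<in> set p"
      using le unfolding tree_le_def by blast
    then have "p = P v" using rooted_tree_unique_vpath[OF R, of p "P v"] P[OF that(3)] by auto
    then obtain p1 p2 where P1: "P v = p1 @ u # p2" using p(4) split_list by metis
    have "u \<in> pverts T" using p by (auto simp: vpath_def vwalk_def)
    moreover have "vpath (p1 @ [u]) (with_proj T)" "hd (p1 @ [u]) = r"
      using P[OF that(3)] vwalkI_append_l[of "p1 @ [u]" p2 "with_proj T"] unfolding P1
      by (auto simp: vpath_def hd_append)
    ultimately have "p1 @ [u] = P u" using rooted_tree_unique_vpath[OF R, of "p1 @ [u]" "P u"] P by auto
    moreover have "p2 \<noteq> []" using P[OF that(3)] that(2) unfolding P1 by auto
    ultimately show ?thesis unfolding P1 by (metis length_append length_greater_0_conv append.assoc append_Cons append_Nil less_add_same_cancel1)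
  qed
  have "u = v" if u: "u \<in> pverts D"
    and v: "v \<in> strong_class (parcs D) {w \<in> pverts D. length (P u) \<le> length (P w)} u"
    and eq: "length (P u) = length (P v)" for u v
  proof (rule ccontr)
    assume "u \<noteq> v"
    let ?S = "strong_class (parcs D) {w \<in> pverts D. length (P u) \<le> length (P w)} u"
    have S: "strong_set (parcs D) ?S" "?S \<subseteq> pverts D" "u \<in> ?S"
      and least: "\<And>w. w \<in> ?S \<Longrightarrow> length (P u) \<le> length (P w)"
      using u strong_class_subset[of "parcs D" "{w \<in> pverts D. length (P u) \<le> length (P w)}" u]
      by (auto intro: strong_set_strong_class strong_class_self)
    have vD: "v \<in> pverts D" using v S by blast
    have incomp: "\<not> tree_le T r u v" "\<not> tree_le T r v u"
      using less[of u v] less[of v u] \<open>u \<noteq> v\<close> eq u vD VT by auto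
    have "strong_subgraph (induced D ?S) D" using strong_subgraph_induced[OF S(1,2) wf] .
    moreover have "u \<in> pverts (induced D ?S) \<inter> pverts T" "v \<in> pverts (induced D ?S) \<inter> pverts T"
      using S(3) v u vD VT by auto
    ultimately have "\<exists>w \<in> pverts (induced D ?S) \<inter> pverts T. tree_le T r w u \<and> tree_le T r w v"
      using W incomp unfolding weak_normal_tree_def by meson
    then obtain w where w: "w \<in> ?S" "tree_le T r w u" "tree_le T r w v" by auto
    then show False using less[of w u] least[of w] incomp u VT by fastforce
  qed
  then have "centered D (\<lambda>v. length (P v))" unfolding centered_def by blast
  then show ?thesis by blast
qed

section \<open>Cones of a centered rank\<close>

locale ranked_digraph = wf_pair_digraph +
  fixes \<rho> :: "'a \<Rightarrow> nat"
  assumes strong_D: "strong_set E V"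
    and centered: "centered D \<rho>"
begin

definition cone :: "'a \<Rightarrow> 'a set" where
  "cone t = strong_class E {w \<in> V. \<rho> t \<le> \<rho> w} t"

definition pred :: "'a \<Rightarrow> 'a set" where
  "pred t = {u \<in> V. t \<in> cone u \<and> u \<noteq> t}"

lemma cone_self: "t \<in> V \<Longrightarrow> t \<in> cone t"
  by (simp add: cone_def strong_class_self)

lemma coneD: "w \<in> cone t \<Longrightarrow> w \<in> V \<and> t \<in> V \<and> \<rho> t \<le> \<rho> w"
  unfolding cone_def using strong_class_subset strong_class_base by fastforce

lemma cone_subset: "cone t \<subseteq> V"
  using coneD by blast

lemma strong_cone: "t \<in> V \<Longrightarrow> strong_set E (cone t)"
  by (simp add: cone_def strong_set_strong_class)

lemma cone_rank_less: "w \<in> cone t \<Longrightarrow> w \<noteq> t \<Longrightarrow> \<rho> t < \<rho> w"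
  using centered coneD[of w t] unfolding centered_def cone_def by (metis le_less)

lemma subset_cone:
  assumes "strong_set E S" "S \<subseteq> V" "x \<in> S" "x \<in> cone u" "\<And>w. w \<in> S \<Longrightarrow> \<rho> u \<le> \<rho> w"
  shows "S \<subseteq> cone u"
  using assms unfolding cone_def by (intro strong_set_subset_class'[OF assms(1) _ assms(3)]) auto

lemma cone_antimono: "v \<in> cone u \<Longrightarrow> cone v \<subseteq> cone u"
  using coneD by (intro subset_cone[of "cone v" v]) (auto intro: strong_cone cone_self dest: coneD le_trans)

text \<open>The cone of \<open>u'\<close> has ranks at least \<open>\<rho> u\<close> and meets
  \<open>cone u\<close> in \<open>v\<close>, so it is absorbed. Thus two cones are nested or
  disjoint.\<close>

lemma cone_linear:
  assumes "v \<in> cone u" "v \<in> cone u'" "\<rho> u \<le> \<rho> u'"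
  shows "u' \<in> cone u"
proof -
  have "cone u' \<subseteq> cone u"
    using assms coneD by (intro subset_cone[of "cone u'" v]) (auto intro: strong_cone dest: coneD le_trans)
  then show ?thesis using assms(2) coneD cone_self by blast
qed

lemma strong_set_minimum:
  assumes "strong_set E S" "S \<subseteq> V"
  obtains m where "m \<in> S" "S \<subseteq> cone m"
proof -
  obtain x where "x \<in> S" using assms by (auto simp: strong_set_def)
  then obtain m where m: "m \<in> S" "\<And>x. x \<in> S \<Longrightarrow> \<rho> m \<le> \<rho> x"
    using ex_has_least_nat[of "\<lambda>x. x \<in> S" x \<rho>] by blast
  then have "S \<subseteq> cone m" using assms by (intro subset_cone[of S m]) (auto intro: cone_self)
  then show ?thesis using that m by blast
qed

lemma predD: "u \<in> pred t \<Longrightarrow> u \<in> V \<and> t \<in> cone u \<and> \<rho> u < \<rho> t"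
  using cone_rank_less by (auto simp: pred_def)

text \<open>By \<open>cone_linear\<close> one of two predecessors lies in the cone of the other,
  hence has strictly larger rank if they differ. So the rank is injective on \<open>pred t\<close>,
  and it is bounded by \<open>\<rho> t\<close>.\<close>

lemma finite_pred: "finite (pred t)"
proof (rule inj_on_finite)
  show "inj_on \<rho> (pred t)"
  proof (rule inj_onI)
    fix u u' assume "u \<in> pred t" "u' \<in> pred t" "\<rho> u = \<rho> u'"
    then show "u = u'"
      using cone_linear[of t u u'] cone_rank_less[of u' u] by (force dest: predD)
  qed
  show "\<rho> ` pred t \<subseteq> {..<\<rho> t}" by (auto dest: predD)
qed simp

text \<open>Exhibits a cone as a component left by a finite deletion, which ties cones to ends and
  their neighbourhoods. The vertex \<open>m\<close> of least rank in the component of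
  \<open>t\<close> has \<open>t\<close> in its cone; if it were not \<open>t\<close>, it would have
  been deleted.\<close>

lemma cone_eq_class:
  assumes "t \<in> V"
  shows "cone t = strong_class E (V - pred t) t"
proof
  have "cone t \<subseteq> V - pred t" using coneD predD by fastforce
  then show "cone t \<subseteq> strong_class E (V - pred t) t"
    using strong_set_subset_class strong_cone cone_self assms by metis
next
  let ?S = "strong_class E (V - pred t) t"
  have t: "t \<in> ?S" using assms by (intro strong_class_self) (auto simp: pred_def)
  have "strong_set E ?S" by (intro strong_set_strong_class) (use assms in \<open>auto simp: pred_def\<close>)
  moreover have sub: "?S \<subseteq> V - pred t" by (rule strong_class_subset)
  ultimately obtain m where m: "m \<in> ?S" "?S \<subseteq> cone m" using strong_set_minimum by blast
  then have "m = t" using t sub by (auto simp: pred_def)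
  then show "?S \<subseteq> cone t" using m by simp
qed

section \<open>The tree of a centered rank\<close>

definition root :: 'a where
  "root = (SOME r. r \<in> V \<and> V \<subseteq> cone r)"

lemma root: "root \<in> V" "V \<subseteq> cone root"
  using someI_ex[of "\<lambda>r. r \<in> V \<and> V \<subseteq> cone r"] strong_set_minimum[OF strong_D] unfolding root_def by auto

lemma pred_root: "pred root = {}"
  using root predD coneD by (metis equals0I leD subset_iff)

definition parent :: "'a \<Rightarrow> 'a" where
  "parent v = (SOME u. u \<in> pred v \<and> (\<forall>w \<in> pred v. \<rho> w \<le> \<rho> u))"

lemma parent:
  assumes "v \<in> V" "v \<noteq> root"
  shows "parent v \<in> pred v" "w \<in> pred v \<Longrightarrow> \<rho> w \<le> \<rho> (parent v)"
proof -
  have "pred v \<noteq> {}" using assms root by (auto simp: pred_def)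
  then have "Max (\<rho> ` pred v) \<in> \<rho> ` pred v" using finite_pred by (intro Max_in) auto
  then have "\<exists>u. u \<in> pred v \<and> (\<forall>w \<in> pred v. \<rho> w \<le> \<rho> u)"
    using finite_pred by (metis (no_types, lifting) Max_ge finite_imageI imageE imageI)
  then have "parent v \<in> pred v \<and> (\<forall>w \<in> pred v. \<rho> w \<le> \<rho> (parent v))"
    unfolding parent_def by (rule someI_ex)
  then show "parent v \<in> pred v" "w \<in> pred v \<Longrightarrow> \<rho> w \<le> \<rho> (parent v)" by auto
qed

lemma pred_eq_insert_parent:
  assumes "v \<in> V" "v \<noteq> root"
  shows "pred v = insert (parent v) (pred (parent v))"
proof (intro set_eqI iffI)
  fix u assume u: "u \<in> pred v"
  then have "parent v \<in> cone u"
    using cone_linear[of v u "parent v"] parent[OF assms] predD by blast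
  then show "u \<in> insert (parent v) (pred (parent v))" using u by (auto simp: pred_def)
next
  fix u assume u: "u \<in> insert (parent v) (pred (parent v))"
  show "u \<in> pred v"
  proof (cases "u = parent v")
    case False
    then have "u \<in> pred (parent v)" using u by simp
    then have "u \<in> V" "parent v \<in> cone u" "\<rho> u < \<rho> v" "v \<in> cone (parent v)"
      using predD parent(1)[OF assms] by (blast, blast, meson less_trans, blast)
    then show ?thesis using cone_antimono by (auto simp: pred_def)
  qed (use parent[OF assms] in simp)
qed

definition tree :: "'a pair_pre_digraph" where
  "tree = \<lparr>pverts = V, parcs = {(u, v). u \<in> V \<and> v \<in> V \<and> (v \<noteq> root \<and> u = parent v \<or> u \<noteq> root \<and> v = parent u)}\<rparr>"

lemma tree_simps [simp]: "pverts tree = V"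
  "(u, v) \<in> parcs tree \<longleftrightarrow> u \<in> V \<and> v \<in> V \<and> (v \<noteq> root \<and> u = parent v \<or> u \<noteq> root \<and> v = parent u)"
  by (simp_all add: tree_def)

lemma parent_rank: "v \<in> V \<Longrightarrow> v \<noteq> root \<Longrightarrow> \<rho> (parent v) < \<rho> v"
  using parent predD by blast

lemma pair_bidirected_tree: "pair_bidirected_digraph tree"
proof unfold_locales
  show "symmetric (with_proj tree)" by (auto simp: symmetric_def sym_def)
  show "fst e \<noteq> snd e" if "e \<in> parcs tree" for e
    using that parent_rank by (cases e) (metis fst_conv less_irrefl snd_conv tree_simps(2))
qed (auto simp: tree_def)

lemma tree_path:
  assumes "v \<in> V"
  shows "\<exists>p. vpath p (with_proj tree) \<and> hd p = root \<and> last p = v \<and> set p = insert v (pred v)"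
  using assms
proof (induction "\<rho> v" arbitrary: v rule: less_induct)
  case less
  show ?case
  proof (cases "v = root")
    case True
    then show ?thesis using root pred_root by (intro exI[of _ "[root]"]) (auto simp: vpath_def)
  next
    case False
    have par: "parent v \<in> V" "\<rho> (parent v) < \<rho> v"
      using parent[OF less.prems False] predD by blast+
    then obtain p where p: "vpath p (with_proj tree)" "hd p = root" "last p = parent v"
      "set p = insert (parent v) (pred (parent v))" using less.hyps by blast
    then have set: "set p = pred v" using pred_eq_insert_parent[OF less.prems False] by simp
    have ne: "p \<noteq> []" using p(1) by (auto simp: vpath_def vwalk_def)
    have "vpath (p @ [v]) (with_proj tree)"
      using p par set False less.prems ne
      by (auto simp: vpath_def vwalk_iff_successively successively_append_iff pred_def)
    then show ?thesis using p ne set by (intro exI[of _ "p @ [v]"]) auto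
  qed
qed

text \<open>On a cycle, both neighbours of a vertex of maximal rank would be its parent.\<close>

lemma tree_no_cycle:
  assumes "pre_digraph.cycle (with_proj tree) c" "3 \<le> length c"
  shows False
proof -
  interpret T: pair_bidirected_digraph tree by (rule pair_bidirected_tree)
  obtain u where c: "T.awalk u c u" "distinct (tl (pawalk_verts u c))"
    using assms(1) unfolding T.cycle_def by auto
  let ?x = "pawalk_verts u c" and ?n = "length c"
  have "c \<noteq> []" using assms(2) by auto
  have pc: "pcas u c u" "set c \<subseteq> parcs tree" using c(1) by (auto simp: T.awalk_def)
  have len: "length (pawalk_verts w d) = Suc (length d)" for w and d :: "('a \<times> 'a) list"
    by (induction d arbitrary: w) auto
  have last: "pawalk_verts w d ! length d = z" if "pcas w d z" for w z and d :: "('a \<times> 'a) list"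
    using that by (induction d arbitrary: w) auto
  have ends: "?x ! 0 = u" "?x ! ?n = u" using pc(1) last[OF pc(1)] by (cases c; simp)+
  have arc: "(?x ! i, ?x ! Suc i) \<in> parcs tree" if "i < ?n" for i
    using pcas_nth[OF pc(1) that] pc(2) that nth_mem by (metis subsetD)
  have inj: "i = j" if "?x ! i = ?x ! j" "0 < i" "0 < j" "i \<le> ?n" "j \<le> ?n" for i j
  proof -
    have "tl ?x ! (i - 1) = tl ?x ! (j - 1)" using that len[of u c] by (simp add: nth_tl)
    then have "i - 1 = j - 1"
      using c(2) that len[of u c] by (subst (asm) nth_eq_iff_index_eq) auto
    then show ?thesis using that by simp
  qed
  obtain i where i: "i \<in> {1..?n}" "\<And>j. j \<in> {1..?n} \<Longrightarrow> \<rho> (?x ! j) \<le> \<rho> (?x ! i)"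
  proof -
    have "finite ((\<lambda>j. \<rho> (?x ! j)) ` {1..?n})" "(\<lambda>j. \<rho> (?x ! j)) ` {1..?n} \<noteq> {}" using assms(2) by auto
    then have "Max ((\<lambda>j. \<rho> (?x ! j)) ` {1..?n}) \<in> (\<lambda>j. \<rho> (?x ! j)) ` {1..?n}" by (rule Max_in)
    then obtain i where "i \<in> {1..?n}" "Max ((\<lambda>j. \<rho> (?x ! j)) ` {1..?n}) = \<rho> (?x ! i)" by blast
    then show ?thesis using that[of i] by (metis (no_types, lifting) Max_ge finite_atLeastAtMost finite_imageI imageI)
  qed
  have par: "w = parent (?x ! i)" if "(w, ?x ! i) \<in> parcs tree \<or> (?x ! i, w) \<in> parcs tree" "\<rho> w \<le> \<rho> (?x ! i)" for w
    using that parent_rank[of w] by (auto simp: not_less[symmetric])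
  \<comment> \<open>Position 0 repeats position \<open>?n\<close>, so the positions from 1 to
    \<open>?n\<close> list each vertex once. \<open>h\<close> and \<open>i'\<close> are the cyclic
    neighbours of \<open>i\<close>, distinct since there are at least three positions.\<close>
  define i' where "i' = (if i = ?n then 1 else Suc i)"
  define h where "h = (if i = 1 then ?n else i - 1)"
  have ih: "i' \<in> {1..?n}" "h \<in> {1..?n}" "h \<noteq> i'" using i(1) assms(2) by (auto simp: i'_def h_def)
  have "(?x ! h, ?x ! i) \<in> parcs tree"
    using arc[of "i - 1"] i(1) ends \<open>c \<noteq> []\<close> by (auto simp: h_def simp del: tree_simps)
  moreover have "(?x ! i, ?x ! i') \<in> parcs tree"
    using arc[of i] arc[of 0] i(1) ends \<open>c \<noteq> []\<close> by (cases "i = ?n") (auto simp: i'_def simp del: tree_simps)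
  ultimately have "?x ! h = ?x ! i'" using par i(2) ih by metis
  then show False using inj[of h i'] ih by auto
qed

lemma rooted_tree_tree: "rooted_tree tree root"
proof -
  interpret T: pair_bidirected_digraph tree by (rule pair_bidirected_tree)
  have 1: "root \<rightarrow>\<^sup>*\<^bsub>with_proj tree\<^esub> v" if "v \<in> V" for v
    using tree_path[OF that] T.reachable_vpath_conv[of root v] by metis
  have 2: "v \<rightarrow>\<^sup>*\<^bsub>with_proj tree\<^esub> root" if "v \<in> V" for v
    using symmetric_reachable[OF T.pair_sym_arcs 1[OF that]] .
  have "strongly_connected (with_proj tree)"
    unfolding strongly_connected_def with_proj_simps tree_simps
    using root(1) T.reachable_trans[OF 2 1] by blast
  then show ?thesis
    unfolding rooted_tree_def using pair_bidirected_tree tree_no_cycle root by auto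
qed

text \<open>The unique root path of \<open>v\<close> runs exactly through
  \<open>insert v (pred v)\<close>.\<close>

lemma tree_le_iff: "tree_le tree root u v \<longleftrightarrow> v \<in> cone u"
proof
  assume "tree_le tree root u v"
  then obtain p where p: "vpath p (with_proj tree)" "hd p = root" "last p = v" "u \<in> set p"
    by (auto simp: tree_le_def)
  then have v: "v \<in> V" by (auto simp: vpath_def vwalk_def)
  then obtain q where q: "vpath q (with_proj tree)" "hd q = root" "last q = v" "set q = insert v (pred v)"
    using tree_path by blast
  then have "p = q" using rooted_tree_unique_vpath[OF rooted_tree_tree] p by metis
  then show "v \<in> cone u" using p q cone_self v by (auto simp: pred_def)
next
  assume v: "v \<in> cone u"
  then have "v \<in> V" "u \<in> insert v (pred v)" using coneD by (auto simp: pred_def)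
  then show "tree_le tree root u v" using tree_path[of v] unfolding tree_le_def by metis
qed

text \<open>The vertex of least rank in a strong subgraph is below all its vertices. For the second
  condition \<open>cone u\<close> itself serves: the vertices strictly below \<open>u\<close> have
  smaller rank.\<close>

lemma weak_normal_tree_tree: "weak_normal_tree D tree root"
  unfolding weak_normal_tree_def tree_le_iff
proof (intro conjI allI impI ballI rooted_tree_tree)
  fix H u v assume H: "strong_subgraph H D" and uv: "u \<in> pverts H \<inter> pverts tree" "v \<in> pverts H \<inter> pverts tree"
  obtain m where "m \<in> pverts H" "pverts H \<subseteq> cone m"
    using strong_set_minimum strong_subgraph_imp_strong_set[OF H] by blast
  then show "\<exists>w\<in>pverts H \<inter> pverts tree. u \<in> cone w \<and> v \<in> cone w"
    using uv strong_subgraph_imp_strong_set[OF H] by auto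
next
  fix u v assume uv: "u \<in> pverts tree" "v \<in> pverts tree" "v \<in> cone u"
  then have "strong_subgraph (induced D (cone u)) D"
    using strong_cone cone_subset wf_D by (intro strong_subgraph_induced) auto
  moreover have "w \<notin> cone u" if "u \<in> cone w \<and> w \<noteq> u" for w
    using that cone_rank_less[of u w] coneD[of w u] by auto
  ultimately show "\<exists>H. strong_subgraph H D \<and> u \<in> pverts H \<and> v \<in> pverts H \<and>
      (\<forall>w\<in>pverts tree. u \<in> cone w \<and> w \<noteq> u \<longrightarrow> w \<notin> pverts H)"
    using uv cone_self by (intro exI[of _ "induced D (cone u)"]) auto
qed simp

lemma ray_necklace:
  assumes "ray_from tree root f"
  shows "\<exists>N \<in> necklaces_in D. range f \<subseteq> pverts N"
proof -
  have f: "inj f" "f 0 = root" "\<And>n. (f n, f (Suc n)) \<in> parcs tree"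
    using assms by (auto simp: ray_from_def simp del: tree_simps)
  then have fV: "f n \<in> V" for n by auto
  \<comment> \<open>Injectivity forbids stepping back to the parent, so the ray climbs
    forever.\<close>
  have step: "f (Suc n) \<noteq> root \<and> parent (f (Suc n)) = f n" for n
  proof (induction n)
    case 0
    then show ?case using f(2) f(3)[of 0] by auto
  next
    case (Suc n)
    have "f (Suc (Suc n)) \<noteq> f n" using f(1) by (auto dest: injD)
    then show ?case using f(3)[of "Suc n"] Suc by auto
  qed
  have next_cone: "f (Suc n) \<in> cone (f n)" and next_rank: "\<rho> (f n) < \<rho> (f (Suc n))" for n
    using parent(1)[OF fV, of "Suc n"] step[of n] predD by metis+
  have cones: "cone (f n) \<subseteq> cone (f m)" if "m \<le> n" for m n
    using lift_Suc_antimono_le[of "\<lambda>n. cone (f n)", OF _ that] cone_antimono[OF next_cone] by blast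
  have rank: "n \<le> \<rho> (f n)" for n
    by (induction n) (use next_rank in \<open>auto intro: Suc_leI le_less_trans\<close>)
  have ex_K: "\<exists>K. finite K \<and> f ` {a..b} \<subseteq> K \<and> K \<subseteq> cone (f a) \<and> strong_set E K" if "a \<le> b" for a b
  proof (rule strong_set_finite_subset)
    show "f ` {a..b} \<subseteq> cone (f a)" using cones cone_self[OF fV] by fastforce
  qed (use strong_cone fV that in auto)
  then obtain K where K: "\<And>a b. a \<le> b \<Longrightarrow> finite (K a b)" "\<And>a b. a \<le> b \<Longrightarrow> f ` {a..b} \<subseteq> K a b"
    "\<And>a b. a \<le> b \<Longrightarrow> K a b \<subseteq> cone (f a)" "\<And>a b. a \<le> b \<Longrightarrow> strong_set E (K a b)" by metis
  \<comment> \<open>Ranks grow without bound along the ray, so a late cone lies above all ranks in a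
    finite set.\<close>
  have avoid: "\<exists>c>b. cone (f c) \<inter> S = {}" if fin: "finite S" for S b
  proof -
    obtain m where m: "\<forall>x\<in>S. \<rho> x < m"
      using finite_imageI[OF fin, of \<rho>] unfolding finite_nat_set_iff_bounded by blast
    have "\<rho> x \<ge> max m (Suc b)" if "x \<in> cone (f (max m (Suc b)))" for x
      using coneD[OF that] rank[of "max m (Suc b)"] by linarith
    then show ?thesis using m by (intro exI[of _ "max m (Suc b)"]) fastforce
  qed
  \<comment> \<open>\<open>g n\<close> holds the ends of the n-th segment of the ray, whose bead is
    \<open>K\<close> of this pair. The next segment is taken so long that the cone at its end misses
    this bead; hence beads two or more apart are disjoint, while neighbours share a vertex of the
    ray.\<close>
  have "\<exists>g. \<forall>n. (fst (g n) < snd (g n) \<and> (n = 0 \<longrightarrow> fst (g n) = (0::nat))) \<and>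
    (fst (g (Suc n)) = snd (g n) \<and> cone (f (snd (g (Suc n)))) \<inter> K (fst (g n)) (snd (g n)) = {})"
  proof (rule dependent_nat_choice[where P = "\<lambda>n (x :: nat \<times> nat). fst x < snd x \<and> (n = 0 \<longrightarrow> fst x = 0)"
        and Q = "\<lambda>n x y. fst y = snd x \<and> cone (f (snd y)) \<inter> K (fst x) (snd x) = {}"])
    show "\<exists>x. fst x < snd x \<and> (0 = (0::nat) \<longrightarrow> fst x = (0::nat))" by (intro exI[of _ "(0, 1)"]) simp
    fix x :: "nat \<times> nat" and n :: nat
    assume "fst x < snd x \<and> (n = 0 \<longrightarrow> fst x = 0)"
    then obtain c where "c > snd x" "cone (f c) \<inter> K (fst x) (snd x) = {}"
      using avoid[OF K(1)] by (meson less_imp_le)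
    then show "\<exists>y. (fst y < snd y \<and> (Suc n = 0 \<longrightarrow> fst y = 0)) \<and>
        fst y = snd x \<and> cone (f (snd y)) \<inter> K (fst x) (snd x) = {}"
      by (intro exI[of _ "(snd x, c)"]) simp
  qed
  then obtain g where g: "\<And>n. fst (g n) < snd (g n)" "fst (g 0) = (0::nat)" "\<And>n. fst (g (Suc n)) = snd (g n)"
    "\<And>n. cone (f (snd (g (Suc n)))) \<inter> K (fst (g n)) (snd (g n)) = {}" by metis
  define a where "a = (\<lambda>n. fst (g n))"
  have a: "a n < a (Suc n)" "a 0 = 0" "cone (f (a (Suc (Suc n)))) \<inter> K (a n) (a (Suc n)) = {}" for n
    using g(1)[of n] g(2) g(3)[of n] g(3)[of "Suc n"] g(4)[of n] by (simp_all add: a_def)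
  have mono: "a m \<le> a n" if "m \<le> n" for m n
    using lift_Suc_mono_le[of a, OF _ that] a(1) by (simp add: less_imp_le)
  let ?K = "\<lambda>n. K (a n) (a (Suc n))"
  note K' = K[OF less_imp_le[OF a(1)]]
  have "f (a (Suc n)) \<in> ?K n" "f (a (Suc n)) \<in> ?K (Suc n)" for n
    using K'(2)[of n] K'(2)[of "Suc n"] a(1)[of n] a(1)[of "Suc n"] by (auto simp: image_subset_iff)
  then have "?K n \<inter> ?K (Suc n) \<noteq> {}" for n by (meson disjoint_iff)
  moreover have "?K i \<inter> ?K j = {}" if "i + 2 \<le> j" for i j
    using a(3)[of i] K'(3)[of j] cones[OF mono, of "Suc (Suc i)" j] that by auto
  moreover have "?K n \<subseteq> V" for n using K'(3)[of n] cone_subset by blast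
  ultimately have "\<exists>N \<in> necklaces_in D. pverts N = (\<Union>n. ?K n)"
    using K' by (intro necklace_of_chain[OF wf_D])
  then obtain N where N: "N \<in> necklaces_in D" "pverts N = (\<Union>n. ?K n)" by blast
  have "f j \<in> pverts N" if "j \<le> a (Suc n)" for n j
    using that
  proof (induction n)
    case 0
    then have "f j \<in> ?K 0" using K'(2)[of 0] a(2) by (auto simp: image_subset_iff)
    then show ?case unfolding N(2) by blast
  next
    case (Suc n)
    show ?case
    proof (cases "j \<le> a (Suc n)")
      case False
      then have "f j \<in> ?K (Suc n)" using K'(2)[of "Suc n"] Suc.prems by (auto simp: image_subset_iff)
      then show ?thesis unfolding N(2) by blast
    qed (use Suc in blast)
  qed
  moreover have "n \<le> a n" for n by (induction n) (use a(1) in \<open>auto intro: Suc_leI le_less_trans\<close>)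
  ultimately have "range f \<subseteq> pverts N" by (metis Suc_leD image_subset_iff)
  then show ?thesis using N(1) by blast
qed

lemma has_normal_spanning_tree: "has_normal_spanning_tree D"
proof -
  have "normal_tree D tree root"
    unfolding normal_tree_def
  proof (intro conjI allI impI weak_normal_tree_tree)
    fix f assume "ray_from tree root f"
    then obtain N where "N \<in> necklaces_in D" "range f \<subseteq> pverts N" using ray_necklace by blast
    then show "\<exists>N\<in>necklaces_in D. finite (range f - pverts N)" by (metis Diff_eq_empty_iff finite.emptyI)
  qed
  then show ?thesis unfolding has_normal_spanning_tree_def by auto
qed

end

section \<open>Metrizability from a family of functions\<close>

text \<open>\<open>equicont\<close> makes balls of the supremum metric neighbourhoods of their
  centres, \<open>detect\<close> makes the generators open for the metric, and
  \<open>separate\<close> gives positive distances.\<close>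

lemma metrizable_space_by_functions:
  fixes F :: "('p \<Rightarrow> real) set" and B :: "'p set set"
  defines "M \<equiv> topspace (topology_generated_by B)"
  assumes nonempty: "F \<noteq> {}"
    and bounds: "\<And>f p. f \<in> F \<Longrightarrow> p \<in> M \<Longrightarrow> 0 \<le> f p \<and> f p \<le> 1"
    and equicont: "\<And>p \<epsilon>. p \<in> M \<Longrightarrow> 0 < \<epsilon> \<Longrightarrow> \<exists>W. openin (topology_generated_by B) W \<and> p \<in> W \<and>
      (\<forall>q\<in>W. \<forall>f\<in>F. \<bar>f p - f q\<bar> \<le> \<epsilon>)"
    and detect: "\<And>S p. S \<in> B \<Longrightarrow> p \<in> S \<Longrightarrow> \<exists>f\<in>F. \<exists>\<delta>>0. \<forall>q\<in>M. \<bar>f p - f q\<bar> < \<delta> \<longrightarrow> q \<in> S"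
    and separate: "\<And>p q. p \<in> M \<Longrightarrow> q \<in> M \<Longrightarrow> p \<noteq> q \<Longrightarrow> \<exists>f\<in>F. f p \<noteq> f q"
  shows "metrizable_space (topology_generated_by B)"
proof -
  \<comment> \<open>The value 0 off \<open>M\<close> is there because nonnegativity and symmetry of
    a metric are required for all points.\<close>
  define d where "d = (\<lambda>p q. if p \<in> M \<and> q \<in> M then SUP f\<in>F. \<bar>f p - f q\<bar> else 0)"
  have bdd: "bdd_above ((\<lambda>f. \<bar>f p - f q\<bar>) ` F)" if "p \<in> M" "q \<in> M" for p q
    by (rule bdd_aboveI[of _ 1]) (use bounds[of _ p] bounds[of _ q] that in fastforce)
  have d_ge: "\<bar>f p - f q\<bar> \<le> d p q" if "p \<in> M" "q \<in> M" "f \<in> F" for p q f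
    unfolding d_def using that cSUP_upper[OF _ bdd, of f p q] by simp
  have d_le: "d p q \<le> e" if "p \<in> M" "q \<in> M" "\<And>f. f \<in> F \<Longrightarrow> \<bar>f p - f q\<bar> \<le> e" for p q e
    unfolding d_def using that cSUP_least[OF nonempty, of "\<lambda>f. \<bar>f p - f q\<bar>" e] by simp
  have d_nonneg: "0 \<le> d p q" for p q
  proof (cases "p \<in> M \<and> q \<in> M")
    case True
    obtain f where "f \<in> F" using nonempty by blast
    then show ?thesis using d_ge[of p q f] True by linarith
  qed (auto simp: d_def)
  interpret Metric_space M d
  proof
    show "0 \<le> d p q" for p q by (rule d_nonneg)
    show "d p q = d q p" for p q by (simp add: d_def abs_minus_commute)
    show "d p q = 0 \<longleftrightarrow> p = q" if "p \<in> M" "q \<in> M" for p q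
    proof
      assume "d p q = 0"
      then show "p = q" using separate[OF that] d_ge[OF that] by fastforce
    next
      assume "p = q"
      then have "d p q \<le> 0" using that by (intro d_le) auto
      then show "d p q = 0" using d_nonneg[of p q] by linarith
    qed
    show "d p r \<le> d p q + d q r" if "p \<in> M" "q \<in> M" "r \<in> M" for p q r
      using that d_ge[of p q] d_ge[of q r] by (intro d_le) (smt (verit))+
  qed
  have "openin (topology_generated_by B) W \<longleftrightarrow> openin mtopology W" for W
  proof
    assume W: "openin (topology_generated_by B) W"
    have "openin mtopology s" if s: "s \<in> B" for s
      unfolding openin_mtopology
    proof (intro conjI allI impI)
      show "s \<subseteq> M" unfolding M_def using s by (meson openin_subset topology_generated_by_Basis)
      fix p assume p: "p \<in> s"
      then obtain f \<delta> where f: "f \<in> F" "\<delta> > 0" "\<forall>q\<in>M. \<bar>f p - f q\<bar> < \<delta> \<longrightarrow> q \<in> s"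
        using detect[OF s] by blast
      have "mball p \<delta> \<subseteq> s" using d_ge[OF _ _ f(1)] f(3) by (force simp: in_mball)
      then show "\<exists>r>0. mball p r \<subseteq> s" using f(2) by blast
    qed
    then show "openin mtopology W"
      by (rule generate_topology_on_coarsest[OF istopology_openin])
        (use W in \<open>simp_all add: openin_topology_generated_by_iff\<close>)
  next
    assume W: "openin mtopology W"
    show "openin (topology_generated_by B) W"
    proof (subst openin_subopen, intro ballI)
      fix p assume p: "p \<in> W"
      then obtain r where r: "r > 0" "mball p r \<subseteq> W" and pM: "p \<in> M" using W unfolding openin_mtopology by blast
      \<comment> \<open>A supremum inherits only the non-strict bound, so half the radius is used to
        stay inside the open ball.\<close>
      then obtain T where T: "openin (topology_generated_by B) T" "p \<in> T"
        "\<forall>q\<in>T. \<forall>f\<in>F. \<bar>f p - f q\<bar> \<le> r / 2" using equicont[OF pM, of "r / 2"] by auto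
      have "T \<subseteq> W"
      proof
        fix q assume q: "q \<in> T"
        then have "q \<in> M" using openin_subset[OF T(1)] by (auto simp: M_def)
        moreover have "d p q \<le> r / 2" using calculation pM q T(3) by (intro d_le) auto
        ultimately show "q \<in> W" using r pM by (auto simp: in_mball)
      qed
      then show "\<exists>T. openin (topology_generated_by B) T \<and> p \<in> T \<and> T \<subseteq> W" using T by blast
    qed
  qed
  then have "topology_generated_by B = mtopology" by (simp add: topology_eq)
  then show ?thesis by (simp add: metrizable_space_mtopology)
qed

section \<open>Nodes near an end\<close>

context wf_pair_digraph
begin

text \<open>\<open>comp_nodes\<close> for an arbitrary vertex set, so that it applies to
  cones.\<close>

definition nodeset :: "'a set \<Rightarrow> 'a node set" where
  "nodeset S = Vert ` S \<union> End ` {\<eta> \<in> ends D. eventually_in \<eta> S}"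

lemma nodeset_mono: "S \<subseteq> S' \<Longrightarrow> nodeset S \<subseteq> nodeset S'"
  unfolding nodeset_def using eventually_in_mono by blast

lemma nodeset_disjoint: "S \<inter> S' = {} \<Longrightarrow> nodeset S \<inter> nodeset S' = {}"
  unfolding nodeset_def using eventually_in_meets by blast

lemma End_in_nodeset: "\<omega> \<in> ends D \<Longrightarrow> eventually_in \<omega> S \<Longrightarrow> End \<omega> \<in> nodeset S"
  by (auto simp: nodeset_def)

lemma comp_nodes_eq_nodeset:
  assumes "\<omega> \<in> ends D" "finite X"
  shows "comp_nodes D X \<omega> = nodeset (end_verts D X \<omega>)"
proof -
  have "end_comp D X \<eta> = end_comp D X \<omega> \<longleftrightarrow> eventually_in \<eta> (end_verts D X \<omega>)" if "\<eta> \<in> ends D" for \<eta>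
    using end_comp_eq_iff[OF that assms] end_verts_eq_class_iff[OF that assms(2)]
      end_verts_class[OF assms] by metis
  then show ?thesis by (auto simp: comp_nodes_def nodeset_def)
qed

lemma End_in_comp_nodes_iff: "End \<eta> \<in> comp_nodes D X \<omega> \<longleftrightarrow> \<eta> \<in> ends D \<and> end_comp D X \<eta> = end_comp D X \<omega>"
  by (auto simp: comp_nodes_def)

lemma comp_nodes_cong: "end_comp D X \<eta> = end_comp D X \<omega> \<Longrightarrow> comp_nodes D X \<eta> = comp_nodes D X \<omega>"
  by (simp add: comp_nodes_def)

lemma comp_nodes_disjoint:
  assumes "\<omega> \<in> ends D" "\<eta> \<in> ends D" "finite X" "end_comp D X \<eta> \<noteq> end_comp D X \<omega>"
  shows "comp_nodes D X \<eta> \<inter> comp_nodes D X \<omega> = {}"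
proof -
  have "end_verts D X \<eta> \<inter> end_verts D X \<omega> = {}"
    using assms end_comp_eq_iff[OF assms(2,1,3)] end_verts_class[OF assms(1,3)] end_verts_class[OF assms(2,3)]
    by (metis disjoint_iff strong_class_eq)
  then show ?thesis using assms by (simp add: comp_nodes_eq_nodeset nodeset_disjoint)
qed

lemma nodes_simps [simp]: "Vert v \<in> nodes D \<longleftrightarrow> v \<in> V" "End \<omega> \<in> nodes D \<longleftrightarrow> \<omega> \<in> ends D"
  by (auto simp: nodes_def)

lemma comp_nodes_subset_nodes: "\<omega> \<in> ends D \<Longrightarrow> finite X \<Longrightarrow> comp_nodes D X \<omega> \<subseteq> nodes D"
  using end_verts_subset by (fastforce simp: comp_nodes_def nodes_def)

lemma limit_edge_nodes:
  assumes "limit_edge D x y"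
  shows "x \<in> nodes D" "y \<in> nodes D" "x \<noteq> y" "\<not> (\<exists>u v. x = Vert u \<and> y = Vert v)"
  using assms by (cases x; cases y; auto)+

lemma edges_nodes:
  assumes "(x, y) \<in> edges D"
  shows "x \<in> nodes D" "y \<in> nodes D"
  using assms limit_edge_nodes pair_wf_digraph.in_arcsD1[OF wf_D] pair_wf_digraph.in_arcsD2[OF wf_D]
  by (auto simp: edges_def)

lemma near_nodes_self: "x \<in> nodes D \<Longrightarrow> x \<in> near_nodes D X x"
  by (cases x) (auto simp: comp_nodes_def)

text \<open>Node sets of components for the same \<open>X\<close> are equal or disjoint.\<close>

lemma near_nodes_comp_iff:
  assumes "x \<in> nodes D" "\<omega> \<in> ends D" "finite X" "a \<in> near_nodes D X x"
  shows "a \<in> comp_nodes D X \<omega> \<longleftrightarrow> x \<in> comp_nodes D X \<omega>"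
proof (cases x)
  case (End \<eta>)
  then have \<eta>: "\<eta> \<in> ends D" "a \<in> comp_nodes D X \<eta>" using assms by auto
  show ?thesis
  proof (cases "end_comp D X \<eta> = end_comp D X \<omega>")
    case True
    then show ?thesis using \<eta> End comp_nodes_cong[OF True] by (simp add: End_in_comp_nodes_iff)
  next
    case False
    then show ?thesis using \<eta> End comp_nodes_disjoint[OF assms(2) \<eta>(1) assms(3) False]
      by (auto simp: End_in_comp_nodes_iff)
  qed
qed (use assms in simp)

lemma near_nodes_trans:
  assumes "x \<in> nodes D" "a \<in> near_nodes D X x"
  shows "near_nodes D X a \<subseteq> near_nodes D X x"
proof (cases x)
  case (End \<omega>)
  show ?thesis
  proof (cases a)
    case (Vert v)
    then show ?thesis using assms by simp
  next
    case a: (End \<eta>)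
    then have "end_comp D X \<eta> = end_comp D X \<omega>" using assms End by (simp add: End_in_comp_nodes_iff)
    from comp_nodes_cong[OF this] show ?thesis using End a by simp
  qed
qed (use assms in auto)

lemma near_nodes_separate:
  assumes "x \<in> nodes D" "a \<in> nodes D" "a \<noteq> x"
  shows "\<exists>X. finite X \<and> a \<notin> near_nodes D X x"
proof (cases x)
  case (Vert v)
  then show ?thesis using assms by (intro exI[of _ "{}"]) auto
next
  case x: (End \<omega>)
  show ?thesis
  proof (cases a)
    case (Vert v)
    then show ?thesis
      using x assms end_verts_subset[of \<omega> "{v}"] by (intro exI[of _ "{v}"]) (auto simp: comp_nodes_def)
  next
    case (End \<eta>)
    then obtain X where X: "finite X" "end_verts D X \<omega> \<inter> end_verts D X \<eta> = {}"
      using ends_separated[of \<omega> \<eta>] assms x by auto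
    have "comp_nodes D X \<omega> \<inter> comp_nodes D X \<eta> = {}"
      using X assms x End by (simp add: comp_nodes_eq_nodeset nodeset_disjoint)
    moreover have "End \<eta> \<in> comp_nodes D X \<eta>" using assms End by (auto simp: comp_nodes_def)
    ultimately show ?thesis using x End X(1) by (intro exI[of _ X]) auto
  qed
qed

lemma basic_opens_cases:
  assumes "S \<in> basic_opens D"
  obtains (star) v \<epsilon> where "S = uniform_star D v \<epsilon>" "v \<in> V" "0 < \<epsilon>"
  | (interval) u v a b where "S = edge_interval u v a b" "(u, v) \<in> E" "0 \<le> a" "a < b" "b \<le> 1"
  | (comp) \<epsilon> X \<omega> where "S = C_hat D \<epsilon> X \<omega>" "\<omega> \<in> ends D" "finite X" "0 < \<epsilon>"
  | (edge) \<epsilon> X x y t where "S = E_hat D \<epsilon> X x y t" "limit_edge D x y" "finite X" "0 < \<epsilon>"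
  using assms unfolding basic_opens_def by (elim UnE) blast+

lemma inner_pointsD:
  assumes "Inner x y t \<in> inner_points D"
  shows "(x, y) \<in> edges D" "0 < t" "t < 1" "x \<in> nodes D" "y \<in> nodes D"
  using assms edges_nodes by (auto simp: inner_points_def)

lemma basic_opens_subset:
  assumes "S \<in> basic_opens D"
  shows "S \<subseteq> points D"
  using assms
proof (cases S rule: basic_opens_cases)
  case (comp \<epsilon> X \<omega>)
  then show ?thesis using comp_nodes_subset_nodes[of \<omega> X] by (auto simp: C_hat_def points_def)
qed (auto simp: uniform_star_def points_def edge_interval_def inner_points_def edges_def E_hat_def)

lemma topspace_DTop_subset: "topspace (DTop D) \<subseteq> points D"
  unfolding DTop_def topology_generated_by_topspace using basic_opens_subset by blast

text \<open>Treats all inner points alike: at an edge between vertices the near nodes are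
  singletons, so \<open>E_hat\<close> is an interval there, although it is a generator only for
  limit edges.\<close>

lemma E_hat_local_base:
  assumes "S \<in> basic_opens D" "Inner x y t \<in> S"
  shows "\<exists>X \<epsilon>. finite X \<and> 0 < \<epsilon> \<and> E_hat D \<epsilon> X x y t \<subseteq> S"
  using assms(1)
proof (cases S rule: basic_opens_cases)
  case (star v e)
  have "x = Vert v \<and> t < e \<or> y = Vert v \<and> 1 - t < e" using assms(2) star by (auto simp: uniform_star_def)
  then show ?thesis
  proof
    assume "x = Vert v \<and> t < e"
    then show ?thesis
      by (intro exI[of _ "{}"] exI[of _ "e - t"]) (auto simp: star E_hat_def uniform_star_def)
  next
    assume "y = Vert v \<and> 1 - t < e"
    then show ?thesis
      by (intro exI[of _ "{}"] exI[of _ "e - (1 - t)"]) (auto simp: star E_hat_def uniform_star_def)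
  qed
next
  case (interval u v a b)
  then show ?thesis using assms(2)
    by (intro exI[of _ "{}"] exI[of _ "min (t - a) (b - t)"]) (auto simp: E_hat_def edge_interval_def abs_less_iff intro!: imageI)
next
  case (comp e X \<omega>)
  let ?C = "comp_nodes D X \<omega>"
  have p: "Inner x y t \<in> inner_points D"
    "x \<in> ?C \<and> y \<in> ?C \<or> x \<in> ?C \<and> y \<notin> ?C \<and> t < e \<or> x \<notin> ?C \<and> y \<in> ?C \<and> 1 - t < e"
    using assms(2) comp by (auto simp: C_hat_def)
  have near: "a \<in> ?C \<longleftrightarrow> x \<in> ?C" "b \<in> ?C \<longleftrightarrow> y \<in> ?C"
    if "a \<in> near_nodes D X x" "b \<in> near_nodes D X y" for a b
    using near_nodes_comp_iff[OF _ comp(2,3)] that inner_pointsD[OF p(1)] by auto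
  from p(2) consider "x \<in> ?C" "y \<in> ?C" | "x \<in> ?C" "y \<notin> ?C" "t < e" | "x \<notin> ?C" "y \<in> ?C" "1 - t < e" by blast
  then show ?thesis
  proof cases
    case 1
    then show ?thesis using comp(3) near
      by (intro exI[of _ X] exI[of _ 1]) (auto simp: comp E_hat_def C_hat_def)
  next
    case 2
    then show ?thesis using comp(3) near
      by (intro exI[of _ X] exI[of _ "e - t"]) (auto simp: comp E_hat_def C_hat_def)
  next
    case 3
    then show ?thesis using comp(3) near
      by (intro exI[of _ X] exI[of _ "e - (1 - t)"]) (auto simp: comp E_hat_def C_hat_def)
  qed
next
  case (edge e X x0 y0 t0)
  then have p: "x \<in> near_nodes D X x0" "y \<in> near_nodes D X y0" "\<bar>t - t0\<bar> < e"
    using assms(2) by (auto simp: E_hat_def)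
  then have "near_nodes D X x \<subseteq> near_nodes D X x0" "near_nodes D X y \<subseteq> near_nodes D X y0"
    using near_nodes_trans limit_edge_nodes[OF edge(2)] by auto
  then show ?thesis using p edge(3)
    by (intro exI[of _ X] exI[of _ "e - \<bar>t - t0\<bar>"]) (auto simp: edge E_hat_def)
qed

end

section \<open>The metric of a centered rank\<close>

text \<open>The maximum matters on a loop at \<open>v\<close>: a sum would be constantly 1 there and
  could not detect a small star.\<close>

definition star_fun :: "'a \<Rightarrow> 'a point \<Rightarrow> real" where
  "star_fun v p = (case p of Node x \<Rightarrow> of_bool (x = Vert v)
    | Inner x y t \<Rightarrow> max (of_bool (x = Vert v) * (1 - t)) (of_bool (y = Vert v) * t))"

text \<open>Unlike \<open>star_fun\<close> it is constantly 1 on edges inside \<open>A\<close>,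
  which \<open>C_hat\<close> contains entirely.\<close>

definition linear_fun :: "'a node set \<Rightarrow> 'a point \<Rightarrow> real" where
  "linear_fun A p = (case p of Node x \<Rightarrow> of_bool (x \<in> A)
    | Inner x y t \<Rightarrow> (1 - t) * of_bool (x \<in> A) + t * of_bool (y \<in> A))"

definition bump_fun :: "'a node set \<Rightarrow> 'a node set \<Rightarrow> real \<Rightarrow> real \<Rightarrow> 'a point \<Rightarrow> real" where
  "bump_fun A B c r p = (case p of Node x \<Rightarrow> 0
    | Inner x y t \<Rightarrow> of_bool (x \<in> A \<and> y \<in> B) * max 0 (r - \<bar>t - c\<bar>))"

section \<open>Cones as neighbourhoods of ends\<close>

context ranked_digraph
begin

lemma end_cone_cofinal:
  assumes "\<omega> \<in> ends D"
  shows "\<exists>t\<in>V. n \<le> \<rho> t \<and> eventually_in \<omega> (cone t)"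
proof (induction n)
  case 0
  have "end_verts D {} \<omega> \<subseteq> cone root" using end_verts_subset[OF assms, of "{}"] root(2) by auto
  then show ?case using eventually_in_mono eventually_in_end_verts[OF assms, of "{}"] root(1) by blast
next
  case (Suc n)
  then obtain t where t: "t \<in> V" "n \<le> \<rho> t" "eventually_in \<omega> (cone t)" by blast
  \<comment> \<open>Deleting \<open>pred t\<close> leaves \<open>cone t\<close>; deleting
    \<open>t\<close> too forces the component of the end to have a least vertex \<open>m\<close> of
    larger rank, whose cone contains that component.\<close>
  let ?X = "insert t (pred t)"
  let ?K = "end_verts D ?X \<omega>"
  have X: "finite ?X" using finite_pred by simp
  have K: "strong_set E ?K" "?K \<subseteq> V - ?X" "eventually_in \<omega> ?K"
    using strong_end_verts[OF assms X] end_verts_subset[OF assms X] eventually_in_end_verts[OF assms X] by auto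
  obtain x where x: "x \<in> ?K" "x \<in> cone t" using eventually_in_meets[OF assms K(3) t(3)] by blast
  have sub: "?K \<subseteq> cone t"
    using strong_set_subset_class'[OF K(1) _ x(1), of "V - pred t" t] x(2) K(2)
    unfolding cone_eq_class[OF t(1)] by blast
  obtain m where m: "m \<in> ?K" "?K \<subseteq> cone m" using strong_set_minimum[OF K(1)] K(2) by blast
  have "m \<in> cone t" "m \<noteq> t" "m \<in> V" using m(1) sub K(2) by auto
  then have "Suc n \<le> \<rho> m" using cone_rank_less[of m t] t(2) by simp
  then show ?case using m eventually_in_mono[OF K(3) m(2)] \<open>m \<in> V\<close> by blast
qed

lemma comp_nodes_pred:
  assumes "\<omega> \<in> ends D" "t \<in> V" "eventually_in \<omega> (cone t)"
  shows "comp_nodes D (pred t) \<omega> = nodeset (cone t)"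
  using assms end_verts_eq_class_iff[OF assms(1) finite_pred, of t t]
  by (simp add: comp_nodes_eq_nodeset[OF assms(1) finite_pred] cone_eq_class)

text \<open>The node sets that shrink to a vertex or to an end, with a vertex \<open>u\<close> that
  carries their rank.\<close>

definition basic_nodes :: "'a \<Rightarrow> 'a node set \<Rightarrow> bool" where
  "basic_nodes u A \<longleftrightarrow> u \<in> V \<and> (A = {Vert u} \<or> A = nodeset (cone u))"

text \<open>A cone of larger rank does not contain \<open>u\<close>, and it is absorbed by
  \<open>cone u\<close> as soon as they meet. Sets of small rank therefore cannot split it.\<close>

lemma basic_nodes_stable:
  assumes "basic_nodes u A" "t \<in> V" "\<rho> u < \<rho> t"
  shows "nodeset (cone t) \<subseteq> A \<or> nodeset (cone t) \<inter> A = {}"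
proof (cases "A = {Vert u}")
  case True
  then show ?thesis using coneD[of u t] assms(3) by (auto simp: nodeset_def)
next
  case False
  then have A: "A = nodeset (cone u)" using assms by (simp add: basic_nodes_def)
  show ?thesis
  proof (cases "cone t \<inter> cone u = {}")
    case True
    then show ?thesis using nodeset_disjoint A by blast
  next
    case False
    then obtain x where x: "x \<in> cone t" "x \<in> cone u" by blast
    have "cone t \<subseteq> cone u"
      using subset_cone[OF strong_cone[OF assms(2)] cone_subset x] coneD[of _ t] assms(3) by force
    then show ?thesis using nodeset_mono A by blast
  qed
qed

text \<open>For an end, take the predecessors of a vertex whose cone contains the end and has rank
  above \<open>n\<close>. Allowing all larger \<open>X'\<close> lets the sets for both endpoints of
  an edge be united.\<close>

lemma near_nodes_stable:
  assumes "x \<in> nodes D"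
  obtains X where "finite X" "X \<subseteq> V" "\<And>v. x = Vert v \<Longrightarrow> v \<in> X"
    "\<And>X' a u A. \<lbrakk>finite X'; X \<subseteq> X'; a \<in> near_nodes D X' x; basic_nodes u A; \<rho> u \<le> n\<rbrakk> \<Longrightarrow> a \<in> A \<longleftrightarrow> x \<in> A"
proof (cases x)
  case (Vert v)
  then show ?thesis using assms by (intro that[of "{v}"]) auto
next
  case (End \<omega>)
  then have w: "\<omega> \<in> ends D" using assms by simp
  obtain t where t: "t \<in> V" "Suc n \<le> \<rho> t" "eventually_in \<omega> (cone t)" using end_cone_cofinal[OF w] by blast
  have stable: "a \<in> A \<longleftrightarrow> x \<in> A"
    if X': "finite X'" "pred t \<subseteq> X'" and a: "a \<in> near_nodes D X' x" and A: "basic_nodes u A" "\<rho> u \<le> n" for X' a u A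
  proof -
    have "a \<in> nodeset (end_verts D X' \<omega>)" using a End comp_nodes_eq_nodeset[OF w X'(1)] by simp
    moreover have "end_verts D X' \<omega> \<subseteq> end_verts D (pred t) \<omega>" using end_verts_antimono[OF w X'] .
    ultimately have "a \<in> comp_nodes D (pred t) \<omega>"
      using nodeset_mono comp_nodes_eq_nodeset[OF w finite_pred] by blast
    then have "a \<in> nodeset (cone t)" using comp_nodes_pred[OF w t(1,3)] by simp
    moreover have "x \<in> nodeset (cone t)" using End_in_nodeset[OF w t(3)] End by simp
    ultimately show ?thesis using basic_nodes_stable[OF A(1) t(1)] A(2) t(2) by force
  qed
  show ?thesis
    by (rule that[of "pred t", OF finite_pred _ _ stable]) (use predD End in auto)
qed

text \<open>A cone whose ranks exceed all ranks in \<open>X\<close> avoids \<open>X\<close>.\<close>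

lemma end_cone_avoids:
  assumes "\<omega> \<in> ends D" "finite X"
  obtains t where "t \<in> V" "eventually_in \<omega> (cone t)" "nodeset (cone t) \<subseteq> comp_nodes D X \<omega>"
proof -
  obtain m where m: "\<forall>x\<in>X. \<rho> x < m"
    using finite_imageI[OF assms(2), of \<rho>] unfolding finite_nat_set_iff_bounded by blast
  obtain t where t: "t \<in> V" "m \<le> \<rho> t" "eventually_in \<omega> (cone t)" using end_cone_cofinal[OF assms(1)] by blast
  have "cone t \<subseteq> V - X" using m t(2) coneD[of _ t] by force
  then have "cone t \<subseteq> end_verts D X \<omega>"
    using eventually_in_subset_end_verts[OF assms strong_cone[OF t(1)]] t(3) by blast
  then show ?thesis using that t comp_nodes_eq_nodeset[OF assms] nodeset_mono by metis
qed

lemma basic_nodes_refine: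
  assumes "x \<in> nodes D" "finite X"
  obtains u A where "basic_nodes u A" "x \<in> A" "A \<subseteq> near_nodes D X x"
proof (cases x)
  case (Vert v)
  then show ?thesis using that[of v "{Vert v}"] assms by (simp add: basic_nodes_def)
next
  case (End \<omega>)
  then have w: "\<omega> \<in> ends D" using assms by simp
  obtain t where "t \<in> V" "eventually_in \<omega> (cone t)" "nodeset (cone t) \<subseteq> comp_nodes D X \<omega>"
    using end_cone_avoids[OF w assms(2)] by blast
  then show ?thesis
    using that[of t "nodeset (cone t)"] End End_in_nodeset[OF w] by (simp add: basic_nodes_def)
qed

text \<open>
  Bumps are only used over pairs of node sets without a common end: otherwise the edges inside
  both sets would make the bump discontinuous at that end.
\<close>

inductive raw_fun :: "nat \<Rightarrow> ('a point \<Rightarrow> real) \<Rightarrow> bool" where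
  star: "v \<in> V \<Longrightarrow> raw_fun (\<rho> v) (star_fun v)"
| linear: "v \<in> V \<Longrightarrow> raw_fun (\<rho> v) (linear_fun (nodeset (cone v)))"
| bump: "basic_nodes u A \<Longrightarrow> basic_nodes v B \<Longrightarrow> A \<inter> B \<inter> range End = {} \<Longrightarrow> 0 < r \<Longrightarrow> r \<le> c \<Longrightarrow> r \<le> 1 - c
    \<Longrightarrow> raw_fun (max (\<rho> u) (\<rho> v)) (bump_fun A B c r)"

section \<open>Equicontinuity of the coordinate functions\<close>

lemma raw_fun_bounds:
  assumes "raw_fun n f" "p \<in> points D"
  shows "0 \<le> f p" "f p \<le> 1"
proof -
  have "(\<exists>x. p = Node x) \<or> (\<exists>x y t. p = Inner x y t \<and> 0 < t \<and> t < 1)"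
    using assms(2) by (auto simp: points_def inner_points_def)
  with assms(1) have "0 \<le> f p \<and> f p \<le> 1"
    by (induction rule: raw_fun.induct) (auto simp: star_fun_def linear_fun_def bump_fun_def)
  then show "0 \<le> f p" "f p \<le> 1" by auto
qed

text \<open>All slopes along an edge are at most 1, and \<open>r \<le> c\<close>,
  \<open>r \<le> 1 - c\<close> make a bump vanish at both ends.\<close>

lemma raw_fun_Lipschitz:
  assumes "raw_fun n f" "0 < t" "t < 1"
  shows "\<bar>f (Node x) - f (Inner x y t)\<bar> \<le> t" "\<bar>f (Node y) - f (Inner x y t)\<bar> \<le> 1 - t"
proof -
  have "\<bar>f (Node x) - f (Inner x y t)\<bar> \<le> t \<and> \<bar>f (Node y) - f (Inner x y t)\<bar> \<le> 1 - t"
    using assms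
    by (induction rule: raw_fun.induct) (auto simp: star_fun_def linear_fun_def bump_fun_def max_def)
  then show "\<bar>f (Node x) - f (Inner x y t)\<bar> \<le> t" "\<bar>f (Node y) - f (Inner x y t)\<bar> \<le> 1 - t" by auto
qed

text \<open>A function of index \<open>n\<close> sees the endpoints of an edge only through the
  basic sets of rank at most \<open>n\<close>; edges that agree there differ only in
  position.\<close>

lemma raw_fun_near_edge:
  assumes "raw_fun n f" "0 < t" "t < 1" "0 < s" "s < 1"
    and x: "\<And>u A. basic_nodes u A \<Longrightarrow> \<rho> u \<le> n \<Longrightarrow> a \<in> A \<longleftrightarrow> x \<in> A"
    and y: "\<And>u A. basic_nodes u A \<Longrightarrow> \<rho> u \<le> n \<Longrightarrow> b \<in> A \<longleftrightarrow> y \<in> A"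
  shows "\<bar>f (Inner x y t) - f (Inner a b s)\<bar> \<le> \<bar>s - t\<bar>"
  using assms
proof (induction rule: raw_fun.induct)
  case (star v)
  have "a = Vert v \<longleftrightarrow> x = Vert v" "b = Vert v \<longleftrightarrow> y = Vert v"
    using star(6)[of v "{Vert v}"] star(7)[of v "{Vert v}"] star(1) by (auto simp: basic_nodes_def)
  then show ?case by (auto simp: star_fun_def)
next
  case (linear v)
  have "a \<in> nodeset (cone v) \<longleftrightarrow> x \<in> nodeset (cone v)" "b \<in> nodeset (cone v) \<longleftrightarrow> y \<in> nodeset (cone v)"
    using linear(6)[of v "nodeset (cone v)"] linear(7)[of v "nodeset (cone v)"] linear(1)
    by (auto simp: basic_nodes_def)
  then show ?case by (auto simp: linear_fun_def)
next
  case (bump u A v B r c)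
  have "a \<in> A \<longleftrightarrow> x \<in> A" "b \<in> B \<longleftrightarrow> y \<in> B" using bump by auto
  then show ?case by (auto simp: bump_fun_def)
qed

lemma raw_fun_near_end:
  assumes "raw_fun n f" "\<omega> \<in> ends D" "t \<in> V" "n < \<rho> t" "eventually_in \<omega> (cone t)"
  shows "x \<in> nodeset (cone t) \<Longrightarrow> f (Node x) = f (Node (End \<omega>))"
    and "x \<in> nodeset (cone t) \<Longrightarrow> y \<in> nodeset (cone t) \<Longrightarrow> f (Inner x y s) = f (Node (End \<omega>))"
proof -
  have \<omega>: "End \<omega> \<in> nodeset (cone t)" using End_in_nodeset[OF assms(2,5)] .
  have "(x \<in> nodeset (cone t) \<longrightarrow> f (Node x) = f (Node (End \<omega>))) \<and>
    (x \<in> nodeset (cone t) \<and> y \<in> nodeset (cone t) \<longrightarrow> f (Inner x y s) = f (Node (End \<omega>)))"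
    using assms(1,4)
  proof (induction rule: raw_fun.induct)
    case (star v)
    have "Vert v \<notin> nodeset (cone t)" using coneD[of v t] star by (auto simp: nodeset_def)
    then show ?case by (auto simp: star_fun_def)
  next
    case (linear v)
    then have "nodeset (cone t) \<subseteq> nodeset (cone v) \<or> nodeset (cone t) \<inter> nodeset (cone v) = {}"
      using basic_nodes_stable[of v "nodeset (cone v)" t] assms(3) by (simp add: basic_nodes_def)
    then show ?case using \<omega> by (auto simp: linear_fun_def)
  next
    case (bump u A v B r c)
    then have "nodeset (cone t) \<subseteq> A \<or> nodeset (cone t) \<inter> A = {}" "nodeset (cone t) \<subseteq> B \<or> nodeset (cone t) \<inter> B = {}"
      using basic_nodes_stable[OF _ assms(3)] by simp_all
    \<comment> \<open>If the cone lay in both \<open>A\<close> and \<open>B\<close>, then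
      \<open>\<omega>\<close> would be a common end; so the bump vanishes on edges inside the
      cone.\<close>
    then show ?case using \<omega> bump(3) by (auto simp: bump_fun_def)
  qed
  then show "x \<in> nodeset (cone t) \<Longrightarrow> f (Node x) = f (Node (End \<omega>))"
    and "x \<in> nodeset (cone t) \<Longrightarrow> y \<in> nodeset (cone t) \<Longrightarrow> f (Inner x y s) = f (Node (End \<omega>))"
    by auto
qed

text \<open>One neighbourhood serves all functions of index at most \<open>N\<close>: a star at a
  vertex, a cone of rank above \<open>N\<close> at an end, and at an inner point an interval or a
  set \<open>E_hat\<close> that basic sets of these ranks cannot split.\<close>

lemma raw_fun_equicontinuous:
  assumes "p \<in> points D" "0 < \<epsilon>"
  shows "\<exists>W. openin (DTop D) W \<and> p \<in> W \<and> (\<forall>q\<in>W. \<forall>n f. raw_fun n f \<and> n \<le> N \<longrightarrow> \<bar>f p - f q\<bar> \<le> \<epsilon>)"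
proof -
  consider (Vert) v where "p = Node (Vert v)" "v \<in> V" | (End) \<omega> where "p = Node (End \<omega>)" "\<omega> \<in> ends D"
    | (Inner) x y t where "p = Inner x y t" "p \<in> inner_points D"
    using assms(1) by (auto simp: points_def nodes_def inner_points_def)
  then show ?thesis
  proof cases
    case Vert
    have "\<bar>f p - f q\<bar> \<le> \<epsilon>" if q: "q \<in> uniform_star D v \<epsilon>" and f: "raw_fun n f" for q n f
    proof (cases q)
      case (Node x)
      then show ?thesis using q Vert assms(2) by (auto simp: uniform_star_def)
    next
      case (Inner x y t)
      then have "Inner x y t \<in> inner_points D" "x = Vert v \<and> t < \<epsilon> \<or> y = Vert v \<and> 1 - t < \<epsilon>"
        using q by (auto simp: uniform_star_def)
      then show ?thesis
        using raw_fun_Lipschitz(1)[OF f, of t x y] raw_fun_Lipschitz(2)[OF f, of t y x]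
          inner_pointsD(2,3)[of x y t] Inner Vert(1) by auto
    qed
    moreover have "p \<in> uniform_star D v \<epsilon>" using Vert by (simp add: uniform_star_def)
    ultimately show ?thesis using openin_uniform_star[OF Vert(2) assms(2)] by blast
  next
    case End
    obtain t where t: "t \<in> V" "Suc N \<le> \<rho> t" "eventually_in \<omega> (cone t)" using end_cone_cofinal[OF End(2)] by blast
    have comp: "comp_nodes D (pred t) \<omega> = nodeset (cone t)" using comp_nodes_pred[OF End(2) t(1,3)] .
    have "\<bar>f p - f q\<bar> \<le> \<epsilon>" if q: "q \<in> C_hat D \<epsilon> (pred t) \<omega>" and f: "raw_fun n f" "n \<le> N" for q n f
    proof -
      have n: "n < \<rho> t" using f(2) t(2) by simp
      note near = raw_fun_near_end[OF f(1) End(2) t(1) n t(3)]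
      show ?thesis
      proof (cases q)
        case (Node x)
        then show ?thesis using q near(1)[of x] End(1) assms(2) by (auto simp: C_hat_def comp)
      next
        case (Inner x y s)
        let ?C = "nodeset (cone t)"
        have xy: "Inner x y s \<in> inner_points D" "x \<in> ?C \<and> y \<in> ?C \<or> x \<in> ?C \<and> s < \<epsilon> \<or> y \<in> ?C \<and> 1 - s < \<epsilon>"
          using q Inner by (auto simp: C_hat_def comp)
        have L: "\<bar>f (Node x) - f q\<bar> \<le> s" "\<bar>f (Node y) - f q\<bar> \<le> 1 - s"
          using raw_fun_Lipschitz(1)[OF f(1), of s x y] raw_fun_Lipschitz(2)[OF f(1), of s y x]
            inner_pointsD(2,3)[OF xy(1)] Inner by auto
        from xy(2) consider "x \<in> ?C" "y \<in> ?C" | "x \<in> ?C" "s < \<epsilon>" | "y \<in> ?C" "1 - s < \<epsilon>" by blast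
        then show ?thesis
        proof cases
          case 1
          then show ?thesis using near(2) End(1) Inner assms(2) by simp
        next
          case 2
          then show ?thesis using L(1) near(1)[of x] End(1) by simp
        next
          case 3
          then show ?thesis using L(2) near(1)[of y] End(1) by simp
        qed
      qed
    qed
    moreover have "p \<in> C_hat D \<epsilon> (pred t) \<omega>" using End by (auto simp: C_hat_def comp_nodes_def)
    moreover have "openin (DTop D) (C_hat D \<epsilon> (pred t) \<omega>)"
      using openin_C_hat[OF End(2) finite_pred _ assms(2), of t] predD by blast
    ultimately show ?thesis by blast
  next
    case Inner
    have xy: "(x, y) \<in> edges D" "0 < t" "t < 1" "x \<in> nodes D" "y \<in> nodes D"
      using inner_pointsD Inner by auto
    show ?thesis
    proof (cases "limit_edge D x y")
      case True
      obtain X where X: "finite X" "X \<subseteq> V" "\<And>v. x = Vert v \<Longrightarrow> v \<in> X"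
        "\<And>X' a u A. finite X' \<Longrightarrow> X \<subseteq> X' \<Longrightarrow> a \<in> near_nodes D X' x \<Longrightarrow> basic_nodes u A \<Longrightarrow> \<rho> u \<le> N \<Longrightarrow> (a \<in> A \<longleftrightarrow> x \<in> A)"
        using near_nodes_stable[OF xy(4), of N] by metis
      obtain Y where Y: "finite Y" "Y \<subseteq> V" "\<And>v. y = Vert v \<Longrightarrow> v \<in> Y"
        "\<And>X' a u A. finite X' \<Longrightarrow> Y \<subseteq> X' \<Longrightarrow> a \<in> near_nodes D X' y \<Longrightarrow> basic_nodes u A \<Longrightarrow> \<rho> u \<le> N \<Longrightarrow> (a \<in> A \<longleftrightarrow> y \<in> A)"
        using near_nodes_stable[OF xy(5), of N] by metis
      let ?W = "E_hat D \<epsilon> (X \<union> Y) x y t"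
      have "?W \<in> basic_opens D"
        unfolding basic_opens_def
        by (intro UnI2 CollectI exI[of _ \<epsilon>] exI[of _ "X \<union> Y"] exI[of _ x] exI[of _ y] exI[of _ t])
          (use True xy X(1-3) Y(1-3) assms(2) in auto)
      then have "openin (DTop D) ?W" unfolding DTop_def by (rule topology_generated_by_Basis)
      moreover have "p \<in> ?W"
        using Inner xy assms(2) near_nodes_self by (auto simp: E_hat_def)
      moreover have "\<bar>f p - f q\<bar> \<le> \<epsilon>" if q: "q \<in> ?W" and f: "raw_fun n f" "n \<le> N" for q n f
      proof -
        obtain a b s where q: "q = Inner a b s" "Inner a b s \<in> inner_points D" "\<bar>s - t\<bar> < \<epsilon>"
          and ab: "a \<in> near_nodes D (X \<union> Y) x" "b \<in> near_nodes D (X \<union> Y) y"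
          using q by (auto simp: E_hat_def)
        have "\<bar>f (Inner x y t) - f (Inner a b s)\<bar> \<le> \<bar>s - t\<bar>"
        proof (rule raw_fun_near_edge[OF f(1) xy(2,3) inner_pointsD(2,3)[OF q(2)]])
          show "a \<in> A \<longleftrightarrow> x \<in> A" if "basic_nodes u A" "\<rho> u \<le> n" for u A
            by (rule X(4)[OF _ _ ab(1) that(1)]) (use X(1) Y(1) that(2) f(2) in auto)
          show "b \<in> A \<longleftrightarrow> y \<in> A" if "basic_nodes u A" "\<rho> u \<le> n" for u A
            by (rule Y(4)[OF _ _ ab(2) that(1)]) (use X(1) Y(1) that(2) f(2) in auto)
        qed
        then show ?thesis using q Inner(1) by simp
      qed
      ultimately show ?thesis by blast
    next
      case False
      then obtain u v where uv: "x = Vert u" "y = Vert v" "(u, v) \<in> E" using xy(1) by (auto simp: edges_def)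
      let ?W = "edge_interval u v (max 0 (t - \<epsilon>)) (min 1 (t + \<epsilon>))"
      have "?W \<in> basic_opens D"
        unfolding basic_opens_def
        by (intro UnI1 UnI2 CollectI exI[of _ u] exI[of _ v] exI[of _ "max 0 (t - \<epsilon>)"] exI[of _ "min 1 (t + \<epsilon>)"])
          (use uv xy assms(2) in auto)
      then have "openin (DTop D) ?W" unfolding DTop_def by (rule topology_generated_by_Basis)
      moreover have "p \<in> ?W" using Inner uv xy assms(2) by (auto simp: edge_interval_def intro!: imageI)
      moreover have "\<bar>f p - f q\<bar> \<le> \<epsilon>" if q: "q \<in> ?W" and f: "raw_fun n f" "n \<le> N" for q n f
      proof -
        obtain s where q: "q = Inner x y s" "0 < s" "s < 1" "\<bar>s - t\<bar> < \<epsilon>"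
          using q uv by (auto simp: edge_interval_def)
        then show ?thesis
          using raw_fun_near_edge[OF f(1) xy(2,3) q(2,3), of x x y y] Inner(1) by simp
      qed
      ultimately show ?thesis by blast
    qed
  qed
qed

end

section \<open>Detection of open sets and separation of points\<close>

context ranked_digraph
begin

lemma near_nodes_antimono:
  assumes "x \<in> nodes D" "finite Y" "X \<subseteq> Y"
  shows "near_nodes D Y x \<subseteq> near_nodes D X x"
proof (cases x)
  case (End \<omega>)
  then have "\<omega> \<in> ends D" "finite X" using assms by (auto intro: finite_subset)
  then show ?thesis
    using End assms end_verts_antimono by (simp add: comp_nodes_eq_nodeset nodeset_mono)
qed simp

text \<open>Supplies the side condition of \<open>bump\<close>. Only an edge between two ends needs
  a separator, since the near nodes of a vertex contain no end.\<close>

lemma edge_no_common_end: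
  assumes "(x, y) \<in> edges D"
  obtains Y where "finite Y" "near_nodes D Y x \<inter> near_nodes D Y y \<inter> range End = {}"
proof (cases "\<exists>\<omega> \<eta>. x = End \<omega> \<and> y = End \<eta>")
  case True
  then obtain \<omega> \<eta> where xy: "x = End \<omega>" "y = End \<eta>" by blast
  then have "limit_edge D (End \<omega>) (End \<eta>)" using assms by (auto simp: edges_def)
  then have w: "\<omega> \<in> ends D" "\<eta> \<in> ends D" "\<omega> \<noteq> \<eta>" by auto
  then obtain X where "finite X" "end_verts D X \<omega> \<inter> end_verts D X \<eta> = {}"
    using ends_separated by blast
  then show ?thesis
    using that[of X] w xy nodeset_disjoint by (simp add: comp_nodes_eq_nodeset)
next
  case False
  then show ?thesis using that[of "{}"] by (cases x; cases y) auto
qed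

lemma detect_inner:
  assumes p: "Inner x y t \<in> inner_points D" and "finite X" "0 < \<epsilon>"
  shows "\<exists>n f \<delta>. raw_fun n f \<and> 0 < \<delta> \<and>
    (\<forall>q \<in> points D. \<bar>f (Inner x y t) - f q\<bar> < \<delta> \<longrightarrow> q \<in> E_hat D \<epsilon> X x y t)"
proof -
  note xy = inner_pointsD[OF p]
  obtain Y where Y: "finite Y" "near_nodes D Y x \<inter> near_nodes D Y y \<inter> range End = {}"
    using edge_no_common_end[OF xy(1)] .
  have fin: "finite (X \<union> Y)" using assms Y by simp
  obtain u A where A: "basic_nodes u A" "x \<in> A" "A \<subseteq> near_nodes D (X \<union> Y) x"
    using basic_nodes_refine[OF xy(4) fin] .
  obtain v B where B: "basic_nodes v B" "y \<in> B" "B \<subseteq> near_nodes D (X \<union> Y) y"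
    using basic_nodes_refine[OF xy(5) fin] .
  have AX: "A \<subseteq> near_nodes D X x" "A \<subseteq> near_nodes D Y x"
    using A(3) near_nodes_antimono[OF xy(4) fin] by blast+
  have BX: "B \<subseteq> near_nodes D X y" "B \<subseteq> near_nodes D Y y"
    using B(3) near_nodes_antimono[OF xy(5) fin] by blast+
  \<comment> \<open>\<open>r\<close> is the height of the bump, the half-width of its support and
    the tolerance at once: a value closer than \<open>r\<close> to the peak is positive, so the
    point lies in the support.\<close>
  define r where "r = min \<epsilon> (min t (1 - t))"
  have r: "0 < r" "r \<le> t" "r \<le> 1 - t" "r \<le> \<epsilon>" using xy assms by (auto simp: r_def)
  have "A \<inter> B \<inter> range End = {}" using AX BX Y(2) by blast
  then have "raw_fun (max (\<rho> u) (\<rho> v)) (bump_fun A B t r)" using A(1) B(1) r by (intro bump)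
  moreover have "q \<in> E_hat D \<epsilon> X x y t"
    if q: "q \<in> points D" "\<bar>bump_fun A B t r (Inner x y t) - bump_fun A B t r q\<bar> < r" for q
  proof -
    have "bump_fun A B t r (Inner x y t) = r" using A(2) B(2) r by (simp add: bump_fun_def)
    then have pos: "0 < bump_fun A B t r q" using q(2) by linarith
    then obtain a b s where "q = Inner a b s" by (cases q) (auto simp: bump_fun_def)
    moreover have "a \<in> A" "b \<in> B" "\<bar>s - t\<bar> < r"
      using pos calculation by (auto simp: bump_fun_def max_def of_bool_def split: if_splits)
    ultimately show ?thesis
      using q(1) AX(1) BX(1) r(4) by (auto simp: E_hat_def points_def)
  qed
  ultimately show ?thesis using r(1) by blast
qed

lemma detect_vertex:
  assumes "v \<in> V" "0 < \<epsilon>"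
  shows "\<exists>n f \<delta>. raw_fun n f \<and> 0 < \<delta> \<and>
    (\<forall>q \<in> points D. \<bar>f (Node (Vert v)) - f q\<bar> < \<delta> \<longrightarrow> q \<in> uniform_star D v \<epsilon>)"
proof -
  have "q \<in> uniform_star D v \<epsilon>"
    \<comment> \<open>Tolerance at most 1 excludes the value 0, hence all other nodes and all edges
      that miss \<open>v\<close>.\<close>
    if q: "q \<in> points D" "\<bar>star_fun v (Node (Vert v)) - star_fun v q\<bar> < min \<epsilon> 1" for q
  proof (cases q)
    case (Node x)
    then show ?thesis using q(2) by (cases "x = Vert v") (auto simp: star_fun_def uniform_star_def)
  next
    case (Inner x y t)
    then have "Inner x y t \<in> inner_points D" using q(1) by (auto simp: points_def)
    then show ?thesis
      using q(2) inner_pointsD(2,3)[of x y t] Inner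
      by (cases "x = Vert v"; cases "y = Vert v") (auto simp: star_fun_def uniform_star_def max_def split: if_splits)
  qed
  then show ?thesis using star[OF assms(1)] assms(2) by (meson min_less_iff_conj zero_less_one)
qed

lemma detect_end:
  assumes "\<omega> \<in> ends D" "finite X" "0 < \<epsilon>"
  shows "\<exists>n f \<delta>. raw_fun n f \<and> 0 < \<delta> \<and>
    (\<forall>q \<in> points D. \<bar>f (Node (End \<omega>)) - f q\<bar> < \<delta> \<longrightarrow> q \<in> C_hat D \<epsilon> X \<omega>)"
proof -
  obtain t where t: "t \<in> V" "eventually_in \<omega> (cone t)" "nodeset (cone t) \<subseteq> comp_nodes D X \<omega>"
    using end_cone_avoids[OF assms(1,2)] .
  let ?C = "nodeset (cone t)"
  have one: "linear_fun ?C (Node (End \<omega>)) = 1" using End_in_nodeset[OF assms(1) t(2)] by (simp add: linear_fun_def)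
  have "q \<in> C_hat D \<epsilon> X \<omega>"
    if q: "q \<in> points D" "\<bar>linear_fun ?C (Node (End \<omega>)) - linear_fun ?C q\<bar> < min \<epsilon> 1" for q
  proof (cases q)
    case (Node x)
    then have "x \<in> ?C" using q(2) one by (cases "x \<in> ?C") (auto simp: linear_fun_def)
    then show ?thesis using Node t(3) by (auto simp: C_hat_def)
  next
    case (Inner x y s)
    then have s: "Inner x y s \<in> inner_points D" "0 < s" "s < 1"
      using q(1) by (auto simp: points_def inner_points_def)
    have less: "1 - linear_fun ?C q < \<epsilon>" "1 - linear_fun ?C q < 1" using q(2) one by auto
    consider "x \<in> ?C" "y \<in> ?C" | "x \<in> ?C" "s < \<epsilon>" | "y \<in> ?C" "1 - s < \<epsilon>"
      using less Inner by (cases "x \<in> ?C"; cases "y \<in> ?C") (auto simp: linear_fun_def)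
    then show ?thesis
      by cases (use s Inner t(3) in \<open>auto simp: C_hat_def\<close>)
  qed
  then show ?thesis using linear[OF t(1)] assms(3) by (meson min_less_iff_conj zero_less_one)
qed

text \<open>Each generator around \<open>p\<close> contains a set of the matching kind centred at
  \<open>p\<close>; at a vertex inside \<open>C_hat\<close> this is the star of the same
  radius.\<close>

lemma detect_basic_open:
  assumes S: "S \<in> basic_opens D" and "p \<in> S"
  shows "\<exists>n f \<delta>. raw_fun n f \<and> 0 < \<delta> \<and> (\<forall>q \<in> points D. \<bar>f p - f q\<bar> < \<delta> \<longrightarrow> q \<in> S)"
proof -
  have p: "p \<in> points D" using basic_opens_subset assms by blast
  show ?thesis
  proof (cases p)
    case Inner: (Inner x y t)
    then have ip: "Inner x y t \<in> inner_points D" using p by (auto simp: points_def)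
    obtain X \<epsilon> where X: "finite X" "0 < \<epsilon>" "E_hat D \<epsilon> X x y t \<subseteq> S"
      using E_hat_local_base[OF S] assms(2) Inner by blast
    then show ?thesis using detect_inner[OF ip X(1,2)] Inner by (meson subsetD)
  next
    case Node: (Node x)
    then have x: "x \<in> nodes D" using p by (auto simp: points_def inner_points_def)
    show ?thesis
    proof (cases x)
      case (Vert v)
      have "\<exists>e>0. uniform_star D v e \<subseteq> S"
        using S
      proof (cases S rule: basic_opens_cases)
        case (star w e)
        then show ?thesis using assms(2) Node Vert by (intro exI[of _ e]) (auto simp: uniform_star_def)
      next
        case (comp e X \<omega>)
        then have "Vert v \<in> comp_nodes D X \<omega>" using assms(2) Node Vert by (auto simp: C_hat_def)
        then show ?thesis using comp(4) unfolding comp(1)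
          by (intro exI[of _ e]) (auto simp: uniform_star_def C_hat_def)
      qed (use assms(2) Node in \<open>auto simp: edge_interval_def E_hat_def\<close>)
      then obtain e where "0 < e" "uniform_star D v e \<subseteq> S" by blast
      then show ?thesis using detect_vertex[of v e] x Vert Node by (meson nodes_simps(1) subsetD)
    next
      case (End \<eta>)
      have "\<exists>e X. 0 < e \<and> finite X \<and> C_hat D e X \<eta> \<subseteq> S"
        using S
      proof (cases S rule: basic_opens_cases)
        case (comp e X \<omega>)
        then have "end_comp D X \<eta> = end_comp D X \<omega>"
          using assms(2) Node End by (auto simp: C_hat_def End_in_comp_nodes_iff)
        from comp_nodes_cong[OF this] have "C_hat D e X \<eta> = S" unfolding comp(1) C_hat_def by (simp only:)
        then show ?thesis using comp(3,4) by (metis subset_refl)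
      qed (use assms(2) Node End in \<open>auto simp: edge_interval_def E_hat_def uniform_star_def\<close>)
      then obtain e X where "0 < e" "finite X" "C_hat D e X \<eta> \<subseteq> S" by blast
      then show ?thesis using detect_end[of \<eta> X e] x End Node by (meson nodes_simps(2) subsetD)
    qed
  qed
qed

lemma raw_fun_separate_nbhd:
  assumes "\<exists>n f \<delta>. raw_fun n f \<and> 0 < \<delta> \<and> (\<forall>q \<in> points D. \<bar>f p - f q\<bar> < \<delta> \<longrightarrow> q \<in> S)"
    and "q \<in> points D" "q \<notin> S"
  shows "\<exists>n f. raw_fun n f \<and> f p \<noteq> f q"
proof -
  obtain n f \<delta> where f: "raw_fun n f" "0 < \<delta>" "\<forall>q \<in> points D. \<bar>f p - f q\<bar> < \<delta> \<longrightarrow> q \<in> S"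
    using assms(1) by blast
  have "f p \<noteq> f q"
  proof
    assume "f p = f q"
    then show False using f(2) bspec[OF f(3) assms(2)] assms(3) by simp
  qed
  then show ?thesis using f(1) by blast
qed

lemma raw_fun_separate:
  assumes "p \<in> points D" "q \<in> points D" "p \<noteq> q"
  shows "\<exists>n f. raw_fun n f \<and> f p \<noteq> f q"
proof -
  let ?sep = "\<lambda>p q. \<exists>n f. raw_fun n f \<and> f p \<noteq> f q"
  have sym: "?sep p q" if "?sep q p" for p q using that by metis
  have vertex: "?sep (Node (Vert v)) q" if "v \<in> V" "q \<in> points D" "q \<noteq> Node (Vert v)" for v q
  proof (cases q)
    case (Node x)
    then show ?thesis
      using raw_fun_separate_nbhd[OF detect_vertex[OF that(1), of 1] that(2)] that(3) by (auto simp: uniform_star_def)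
  next
    case (Inner x y t)
    \<comment> \<open>The star of this radius leaves out \<open>q\<close>, also when
      \<open>q\<close> lies on a loop at \<open>v\<close>.\<close>
    then have "0 < min t (1 - t)" using that(2) by (auto simp: points_def inner_points_def)
    then show ?thesis
      using raw_fun_separate_nbhd[OF detect_vertex[OF that(1)] that(2), of "min t (1 - t)"] Inner
      by (auto simp: uniform_star_def)
  qed
  have inner: "?sep (Inner x y t) q" if p: "Inner x y t \<in> inner_points D" and q: "q \<in> points D" "q \<noteq> Inner x y t" for x y t q
  proof -
    have "\<exists>X \<epsilon>. finite X \<and> 0 < \<epsilon> \<and> q \<notin> E_hat D \<epsilon> X x y t"
    proof (cases q)
      case (Node z)
      then show ?thesis by (intro exI[of _ "{}"] exI[of _ 1]) (auto simp: E_hat_def)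
    next
      case (Inner a b s)
      then have "Inner a b s \<in> inner_points D" using q by (auto simp: points_def)
      then have ab: "a \<in> nodes D" "b \<in> nodes D" using inner_pointsD by auto
      consider "a \<noteq> x" | "b \<noteq> y" | "s \<noteq> t" using q(2) Inner by auto
      then show ?thesis
      proof cases
        case 1
        then obtain X where "finite X" "a \<notin> near_nodes D X x"
          using near_nodes_separate[OF inner_pointsD(4)[OF p] ab(1)] by blast
        then show ?thesis using Inner by (intro exI[of _ X] exI[of _ 1]) (auto simp: E_hat_def)
      next
        case 2
        then obtain X where "finite X" "b \<notin> near_nodes D X y"
          using near_nodes_separate[OF inner_pointsD(5)[OF p] ab(2)] by blast
        then show ?thesis using Inner by (intro exI[of _ X] exI[of _ 1]) (auto simp: E_hat_def)
      next
        case 3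
        then show ?thesis using Inner by (intro exI[of _ "{}"] exI[of _ "\<bar>s - t\<bar>"]) (auto simp: E_hat_def)
      qed
    qed
    then obtain X \<epsilon> where X: "finite X" "0 < \<epsilon>" "q \<notin> E_hat D \<epsilon> X x y t" by blast
    show ?thesis using raw_fun_separate_nbhd[OF detect_inner[OF p X(1,2)] q(1) X(3)] .
  qed
  have ends: "?sep (Node (End \<omega>)) (Node (End \<eta>))" if ne: "\<omega> \<in> ends D" "\<eta> \<in> ends D" "\<omega> \<noteq> \<eta>" for \<omega> \<eta>
  proof -
    obtain X where X: "finite X" "End \<eta> \<notin> near_nodes D X (End \<omega>)"
      using near_nodes_separate[of "End \<omega>" "End \<eta>"] ne by auto
    show ?thesis
    proof (rule raw_fun_separate_nbhd[OF detect_end[OF that(1) X(1), of 1]])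
      show "Node (End \<eta>) \<in> points D" using that by (auto simp: points_def)
      show "Node (End \<eta>) \<notin> C_hat D 1 X \<omega>" using X(2) by (auto simp: C_hat_def)
    qed simp
  qed
  show ?thesis
  proof (cases p)
    case (Inner x y t)
    then show ?thesis using inner assms by (auto simp: points_def)
  next
    case p: (Node x)
    show ?thesis
    proof (cases q)
      case (Inner x y t)
      then show ?thesis using sym inner assms by (auto simp: points_def)
    next
      case q: (Node y)
      have xy: "x \<in> nodes D" "y \<in> nodes D" using assms p q by (auto simp: points_def inner_points_def)
      show ?thesis
      proof (cases x)
        case (Vert v)
        then show ?thesis using vertex[of v q] p xy assms by auto
      next
        case x: (End \<omega>)
        show ?thesis
        proof (cases y)
          case (Vert v)
          then show ?thesis using sym vertex[of v p] q xy assms by auto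
        next
          case (End \<eta>)
          then show ?thesis using ends[of \<omega> \<eta>] x p q xy assms by auto
        qed
      qed
    qed
  qed
qed

lemma metrizable_DTop: "metrizable_space (DTop D)"
proof -
  define F where "F = {\<lambda>p. (1 / 2) ^ n * f p | n f. raw_fun n f}"
  have top: "p \<in> points D" if "p \<in> topspace (DTop D)" for p using topspace_DTop_subset that by blast
  have scale: "(1 / 2 :: real) ^ n \<le> 1" "0 < (1 / 2 :: real) ^ n" for n by (auto intro: power_le_one)
  have diff: "\<bar>(1 / 2) ^ n * a - (1 / 2) ^ n * b\<bar> = (1 / 2) ^ n * \<bar>a - b\<bar>" for n :: nat and a b :: real
    by (simp add: abs_mult flip: right_diff_distrib)
  show ?thesis
    unfolding DTop_def
  proof (rule metrizable_space_by_functions[where F = F]; (unfold DTop_def[symmetric])?)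
    show "F \<noteq> {}" using star[OF root(1)] by (auto simp: F_def)
    show "0 \<le> g p \<and> g p \<le> 1" if "g \<in> F" "p \<in> topspace (DTop D)" for g p
      using that raw_fun_bounds top scale by (fastforce simp: F_def intro: mult_le_one)
    show "\<exists>W. openin (DTop D) W \<and> p \<in> W \<and> (\<forall>q\<in>W. \<forall>g\<in>F. \<bar>g p - g q\<bar> \<le> \<epsilon>)"
      if p: "p \<in> topspace (DTop D)" and \<epsilon>: "0 < \<epsilon>" for p \<epsilon>
    proof -
      \<comment> \<open>Up to index \<open>N\<close> equicontinuity applies; beyond it the weight is
        below \<open>\<epsilon>\<close> and all values lie between 0 and 1.\<close>
      obtain N where N: "(1 / 2 :: real) ^ N < \<epsilon>" using real_arch_pow_inv[OF \<epsilon>, of "1 / 2"] by auto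
      obtain W where W: "openin (DTop D) W" "p \<in> W"
        "\<And>q n f. q \<in> W \<Longrightarrow> raw_fun n f \<Longrightarrow> n \<le> N \<Longrightarrow> \<bar>f p - f q\<bar> \<le> \<epsilon>"
        using raw_fun_equicontinuous[OF top[OF p] \<epsilon>, of N] by blast
      have "\<bar>g p - g q\<bar> \<le> \<epsilon>" if q: "q \<in> W" and "g \<in> F" for q g
      proof -
        obtain n f where f: "raw_fun n f" "g = (\<lambda>p. (1 / 2) ^ n * f p)" using \<open>g \<in> F\<close> by (auto simp: F_def)
        have qt: "q \<in> points D" using openin_subset[OF W(1)] q top by blast
        show ?thesis
        proof (cases "n \<le> N")
          case True
          have "(1 / 2) ^ n * \<bar>f p - f q\<bar> \<le> 1 * \<bar>f p - f q\<bar>" using scale by (intro mult_right_mono) auto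
          then show ?thesis using W(3)[OF q f(1) True] f(2) diff by simp
        next
          case False
          have "\<bar>f p - f q\<bar> \<le> 1"
            using raw_fun_bounds[OF f(1) qt] raw_fun_bounds[OF f(1) top[OF p]] by auto
          then have "(1 / 2) ^ n * \<bar>f p - f q\<bar> \<le> (1 / 2) ^ n * 1" using scale(2)[of n] by (intro mult_left_mono) auto
          also have "\<dots> \<le> (1 / 2) ^ N" using False by (auto intro: power_decreasing)
          finally show ?thesis using N f(2) diff by simp
        qed
      qed
      then show ?thesis using W(1,2) by blast
    qed
    show "\<exists>g\<in>F. \<exists>\<delta>>0. \<forall>q\<in>topspace (DTop D). \<bar>g p - g q\<bar> < \<delta> \<longrightarrow> q \<in> S" if S: "S \<in> basic_opens D" "p \<in> S" for S p
    proof -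
      obtain n f \<delta> where f: "raw_fun n f" "0 < \<delta>" "\<forall>q \<in> points D. \<bar>f p - f q\<bar> < \<delta> \<longrightarrow> q \<in> S"
        using detect_basic_open[OF S] by blast
      have "q \<in> S" if "q \<in> topspace (DTop D)" "\<bar>(1 / 2) ^ n * f p - (1 / 2) ^ n * f q\<bar> < (1 / 2) ^ n * \<delta>" for q
        using that f(3) top scale(2)[of n] unfolding diff by simp
      then show ?thesis using f(1,2) scale(2)[of n]
        by (intro bexI[of _ "\<lambda>p. (1 / 2) ^ n * f p"] exI[of _ "(1 / 2) ^ n * \<delta>"]) (auto simp: F_def)
    qed
    show "\<exists>g\<in>F. g p \<noteq> g q" if pq: "p \<in> topspace (DTop D)" "q \<in> topspace (DTop D)" "p \<noteq> q" for p q
    proof -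
      obtain n f where f: "raw_fun n f" "f p \<noteq> f q" using raw_fun_separate[OF top top] pq by blast
      then show ?thesis by (intro bexI[of _ "\<lambda>p. (1 / 2) ^ n * f p"]) (auto simp: F_def)
    qed
  qed
qed

end

theorem theorem1p4:
  fixes D :: "'a pair_pre_digraph"
  assumes "pair_wf_digraph D" and "strongly_connected D"
  shows "metrizable_space (DTop D) \<longleftrightarrow> has_normal_spanning_tree D"
proof -
  interpret wf_pair_digraph D using assms(1) by (rule wf_pair_digraph.intro)
  have strong: "strong_set (parcs D) (pverts D)"
    using assms(2) by (simp add: strongly_connected_iff_strong_set)
  have "has_normal_spanning_tree D \<longleftrightarrow> (\<exists>\<rho>. centered D \<rho>)"
  proof
    assume "\<exists>\<rho>. centered D \<rho>"
    then obtain \<rho> where "centered D \<rho>" by blast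
    then interpret ranked_digraph D \<rho> using strong by unfold_locales
    show "has_normal_spanning_tree D" by (rule has_normal_spanning_tree)
  qed (rule normal_spanning_tree_imp_centered[OF assms(1)])
  moreover have "metrizable_space (DTop D) \<longleftrightarrow> (\<exists>\<rho>. centered D \<rho>)"
  proof
    assume "metrizable_space (DTop D)"
    then obtain U where U: "pverts D \<subseteq> (\<Union>n::nat. U n)" "\<And>n. dispersed D (U n)"
      using metrizable_imp_dispersed_cover by blast
    then interpret dispersed_cover D U using strong by unfold_locales
    show "\<exists>\<rho>. centered D \<rho>" by (rule centered_exists)
  next
    assume "\<exists>\<rho>. centered D \<rho>"
    then obtain \<rho> where "centered D \<rho>" by blast
    then interpret ranked_digraph D \<rho> using strong by unfold_locales
    show "metrizable_space (DTop D)" by (rule metrizable_DTop)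
  qed
  ultimately show ?thesis by simp
qed

end
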